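(* Let $X=(V,E)$ be a (finite or infinite) distance-regular graph, and let $p_{i,j}^k$ be the intersection numbers of the association scheme $(V,\mathcal{R}(X))$. For $i\in I$ let $A^{(i)}$ be the $V\times V$ matrix whose $(v,w)$ entry is $1$ if $d(v,w)=i$ and $0$ otherwise, and let $C^{(i)}=(p_{i,i}^0)^{-1}A^{(i)}$. Then for any base point $v_0\in V$ and all $i,j\in I$, $$C^{(i)}C^{(j)}=\sum_{k\in I}P_{i,j}^k\,C^{(k)},$$ where $P_{i,j}^k$ are the coefficients in $R_i\circ_{v_0}R_j=\sum_{k\in I}P_{i,j}^kR_k$. Consequently $\{C^{(i)}\}_{i\in I}$, with matrix multiplication as convolution and the conjugate-linear involution fixing every $C^{(i)}$, is a hermitian discrete hypergroup with the same structure as $(\mathcal{R}(X),\circ_{v_0})$, via $R_i\mapsto C^{(i)}$.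
   Context: **Discrete hypergroup.** For a set $K$, let $\mathbb{C}K$ be the free complex vector space on $K$ (for a linearly independent set of matrices, identified with its linear span); for $\mu\in\mathbb{C}K$ let $\mu(x)$ be the coefficient of $x\in K$, $\|\mu\|_1=\sum_{x}|\mu(x)|$, $\mathrm{supp}(\mu)=\{x\in K: \mu(x)\ne 0\}$. $K$, with a bilinear convolution $\circ$ on $\mathbb{C}K$ and a map $*:\mathbb{C}K\to\mathbb{C}K$, is a discrete hypergroup if: (i) $(\mathbb{C}K,\circ,* )$ is an associative $*$-algebra ($*$ is conjugate-linear, involutive and anti-multiplicative) with a neutral element $e\in K$; (ii) for all $x,y,z\in K$, $(x\circ y)(z)\ge 0$ is real, and $\|x\circ y\|_1=1$; (iii) $*$ maps $K$ onto $K$; (iv) for $x,y\in K$, $e\in\mathrm{supp}(x\circ y)$ if and only if $y=x^*$. It is hermitian if $*$ restricted to $K$ is the identity. **Construction from a graph.** All graphs are simple, connected, with all vertices of finite degree; $d$ is the graph distance, $\mathrm{diam}(X)\in\mathbb{N}_0\cup\{\infty\}$ the supremum of distances, $\Gamma_i(v)=\{w\in V: d(v,w)=i\}$. Let $I=\{i\in\mathbb{N}_0: i\le \mathrm{diam}(X)\}$, $R_i=\{(v,w)\in V\times V: d(v,w)=i\}$, $\mathcal{R}(X)=\{R_i\}_{i\in I}$. For $v_0\in V$ put $$P_{i,j}^k=\frac{1}{|\Gamma_i(v_0)|}\sum_{v\in\Gamma_i(v_0)}\frac{|\Gamma_j(v)\cap\Gamma_k(v_0)|}{|\Gamma_j(v)|}\qquad(i,j,k\in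 I),$$ and define the bilinear convolution $\circ_{v_0}$ on $\mathbb{C}\mathcal{R}(X)$ by $R_i\circ_{v_0}R_j=\sum_{k\in I}P_{i,j}^kR_k$; the involution on $\mathbb{C}\mathcal{R}(X)$ is the conjugate-linear map fixing every $R_i$. **Distance-regular graph.** A connected graph $X$ is distance-regular if there exist positive integers $b_i$ ($0\le i<\mathrm{diam}(X)$) and $c_i$ ($i\ge 1$, $i\le\mathrm{diam}(X)$, $i<\infty$) such that: $|\Gamma_1(v)|=b_0$ for all $v\in V$; for $1\le i<\mathrm{diam}(X)$ and all $v,w$ with $d(v,w)=i$, $|\Gamma_{i+1}(v)\cap\Gamma_1(w)|=b_i$ and $|\Gamma_{i-1}(v)\cap\Gamma_1(w)|=c_i$; and, if $s=\mathrm{diam}(X)<\infty$, $|\Gamma_{s-1}(v)\cap\Gamma_1(w)|=c_s$ whenever $d(v,w)=s$. For such $X$, the pair $(V,\mathcal{R}(X))$ is a symmetric association scheme: for $i,j,k\in I$ the number $p_{i,j}^k=|\{u\in V: d(v,u)=i,\ d(u,w)=j\}|$ is finite and the same for all $(v,w)\in R_k$; these are its intersection numbers. *)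

theory Defs
  imports
    "HOL-Analysis.Analysis"
    "HOL-Library.Poly_Mapping"
    "HOL-Library.Function_Algebras"
begin

section \<open>Discrete hypergroups\<close>

text \<open>
  The space \<open>\<complex>K\<close> is modelled as the span of a linearly independent subset \<open>K\<close> of a complex vector
  space with scalar multiplication \<open>smul\<close>; the coefficient \<open>\<mu>(x)\<close> is
  \<open>module.representation smul K \<mu> x\<close>. The free vector space on an abstract set is the case of the
  basis \<open>Poly_Mapping.single x 1\<close> in finitely supported functions, see \<open>basis_rel\<close> below; for a
  linearly independent set of matrices one gets its linear span.
\<close>

definition hg_supp :: "(complex \<Rightarrow> 'b::ab_group_add \<Rightarrow> 'b) \<Rightarrow> 'b set \<Rightarrow> 'b \<Rightarrow> 'b set" where
  "hg_supp smul K \<mu> = {x \<in> K. module.representation smul K \<mu> x \<noteq> 0}"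

definition hg_norm1 :: "(complex \<Rightarrow> 'b::ab_group_add \<Rightarrow> 'b) \<Rightarrow> 'b set \<Rightarrow> 'b \<Rightarrow> real" where
  "hg_norm1 smul K \<mu> = (\<Sum>x \<in> hg_supp smul K \<mu>. cmod (module.representation smul K \<mu> x))"

text \<open>The conjugate-linear map on \<open>\<complex>K\<close> that fixes every element of \<open>K\<close>.\<close>

definition conj_fixing :: "(complex \<Rightarrow> 'b::ab_group_add \<Rightarrow> 'b) \<Rightarrow> 'b set \<Rightarrow> 'b \<Rightarrow> 'b" where
  "conj_fixing smul K \<mu> =
     (\<Sum>x \<in> hg_supp smul K \<mu>. smul (cnj (module.representation smul K \<mu> x)) x)"

locale star_algebra_on = vector_space smul
  for smul :: "complex \<Rightarrow> 'b::ab_group_add \<Rightarrow> 'b" (infixr "*s" 75) +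
  fixes A :: "'b set"
    and conv :: "'b \<Rightarrow> 'b \<Rightarrow> 'b" (infixl "\<star>" 70)
    and star :: "'b \<Rightarrow> 'b"
  assumes subspace_A: "subspace A"
    and conv_closed: "x \<in> A \<Longrightarrow> y \<in> A \<Longrightarrow> x \<star> y \<in> A"
    and conv_add_left: "x \<in> A \<Longrightarrow> y \<in> A \<Longrightarrow> z \<in> A \<Longrightarrow> (x + y) \<star> z = x \<star> z + y \<star> z"
    and conv_add_right: "x \<in> A \<Longrightarrow> y \<in> A \<Longrightarrow> z \<in> A \<Longrightarrow> x \<star> (y + z) = x \<star> y + x \<star> z"
    and conv_scale_left: "x \<in> A \<Longrightarrow> y \<in> A \<Longrightarrow> (a *s x) \<star> y = a *s (x \<star> y)"
    and conv_scale_right: "x \<in> A \<Longrightarrow> y \<in> A \<Longrightarrow> x \<star> (a *s y) = a *s (x \<star> y)"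
    and conv_assoc: "x \<in> A \<Longrightarrow> y \<in> A \<Longrightarrow> z \<in> A \<Longrightarrow> (x \<star> y) \<star> z = x \<star> (y \<star> z)"
    and star_closed: "x \<in> A \<Longrightarrow> star x \<in> A"
    and star_add: "x \<in> A \<Longrightarrow> y \<in> A \<Longrightarrow> star (x + y) = star x + star y"
    and star_scale: "x \<in> A \<Longrightarrow> star (a *s x) = cnj a *s star x"
    and star_star: "x \<in> A \<Longrightarrow> star (star x) = x"
    and star_conv: "x \<in> A \<Longrightarrow> y \<in> A \<Longrightarrow> star (x \<star> y) = star y \<star> star x"

definition discrete_hypergroup ::
  "(complex \<Rightarrow> 'b::ab_group_add \<Rightarrow> 'b) \<Rightarrow> 'b set \<Rightarrow> ('b \<Rightarrow> 'b \<Rightarrow> 'b) \<Rightarrow> ('b \<Rightarrow> 'b) \<Rightarrow> bool" where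
  "discrete_hypergroup smul K conv star \<longleftrightarrow>
     vector_space smul \<and> \<not> module.dependent smul K \<and>
     star_algebra_on smul (module.span smul K) conv star \<and>
     (\<exists>e \<in> K.
        (\<forall>\<mu> \<in> module.span smul K. conv e \<mu> = \<mu> \<and> conv \<mu> e = \<mu>) \<and>
        (\<forall>x \<in> K. \<forall>y \<in> K. \<forall>z \<in> K. module.representation smul K (conv x y) z \<in> \<real>\<^sub>\<ge>\<^sub>0) \<and>
        (\<forall>x \<in> K. \<forall>y \<in> K. hg_norm1 smul K (conv x y) = 1) \<and>
        star ` K = K \<and>
        (\<forall>x \<in> K. \<forall>y \<in> K. e \<in> hg_supp smul K (conv x y) \<longleftrightarrow> y = star x))"

definition hermitian_discrete_hypergroup ::
  "(complex \<Rightarrow> 'b::ab_group_add \<Rightarrow> 'b) \<Rightarrow> 'b set \<Rightarrow> ('b \<Rightarrow> 'b \<Rightarrow> 'b) \<Rightarrow> ('b \<Rightarrow> 'b) \<Rightarrow> bool" where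
  "hermitian_discrete_hypergroup smul K conv star \<longleftrightarrow>
     discrete_hypergroup smul K conv star \<and> (\<forall>x \<in> K. star x = x)"

text \<open>A linear \<open>*\<close>-algebra isomorphism \<open>\<complex>K \<rightarrow> \<complex>L\<close> that carries \<open>K\<close> bijectively to \<open>L\<close>.\<close>

definition hypergroup_iso ::
  "(complex \<Rightarrow> 'b::ab_group_add \<Rightarrow> 'b) \<Rightarrow> 'b set \<Rightarrow> ('b \<Rightarrow> 'b \<Rightarrow> 'b) \<Rightarrow> ('b \<Rightarrow> 'b) \<Rightarrow>
   (complex \<Rightarrow> 'c::ab_group_add \<Rightarrow> 'c) \<Rightarrow> 'c set \<Rightarrow> ('c \<Rightarrow> 'c \<Rightarrow> 'c) \<Rightarrow> ('c \<Rightarrow> 'c) \<Rightarrow>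
   ('b \<Rightarrow> 'c) \<Rightarrow> bool" where
  "hypergroup_iso smul K conv star smul' L conv' star' \<phi> \<longleftrightarrow>
     bij_betw \<phi> (module.span smul K) (module.span smul' L) \<and>
     bij_betw \<phi> K L \<and>
     (\<forall>\<mu> \<in> module.span smul K. \<forall>\<nu> \<in> module.span smul K.
        \<phi> (\<mu> + \<nu>) = \<phi> \<mu> + \<phi> \<nu> \<and> \<phi> (conv \<mu> \<nu>) = conv' (\<phi> \<mu>) (\<phi> \<nu>)) \<and>
     (\<forall>\<mu> \<in> module.span smul K.
        (\<forall>a. \<phi> (smul a \<mu>) = smul' a (\<phi> \<mu>)) \<and> \<phi> (star \<mu>) = star' (\<phi> \<mu>))"


section \<open>Graphs\<close>

text \<open>A graph is a vertex set \<open>V\<close> with a symmetric irreflexive adjacency relation \<open>E\<close>.\<close>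

definition simple_graph :: "'a set \<Rightarrow> ('a \<times> 'a) set \<Rightarrow> bool" where
  "simple_graph V E \<longleftrightarrow> E \<subseteq> V \<times> V \<and> sym E \<and> irrefl E"

definition connected_graph :: "'a set \<Rightarrow> ('a \<times> 'a) set \<Rightarrow> bool" where
  "connected_graph V E \<longleftrightarrow> (\<forall>v \<in> V. \<forall>w \<in> V. (v, w) \<in> E\<^sup>*)"

definition finite_degrees :: "'a set \<Rightarrow> ('a \<times> 'a) set \<Rightarrow> bool" where
  "finite_degrees V E \<longleftrightarrow> (\<forall>v \<in> V. finite {w \<in> V. (v, w) \<in> E})"

definition graph_dist :: "('a \<times> 'a) set \<Rightarrow> 'a \<Rightarrow> 'a \<Rightarrow> nat" where
  "graph_dist E v w = (LEAST n. (v, w) \<in> E ^^ n)"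

definition graph_diam :: "'a set \<Rightarrow> ('a \<times> 'a) set \<Rightarrow> enat" where
  "graph_diam V E = (SUP v \<in> V. SUP w \<in> V. enat (graph_dist E v w))"

definition sphere_at :: "'a set \<Rightarrow> ('a \<times> 'a) set \<Rightarrow> nat \<Rightarrow> 'a \<Rightarrow> 'a set" where
  "sphere_at V E i v = {w \<in> V. graph_dist E v w = i}"

definition dist_indices :: "'a set \<Rightarrow> ('a \<times> 'a) set \<Rightarrow> nat set" where
  "dist_indices V E = {i. enat i \<le> graph_diam V E}"

definition dist_rel :: "'a set \<Rightarrow> ('a \<times> 'a) set \<Rightarrow> nat \<Rightarrow> ('a \<times> 'a) set" where
  "dist_rel V E i = {(v, w). v \<in> V \<and> w \<in> V \<and> graph_dist E v w = i}"

text \<open>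
  The constants \<open>b i\<close> are only required for \<open>i < diam\<close> and \<open>c i\<close> only for \<open>1 \<le> i \<le> diam\<close>; values of
  \<open>b\<close> and \<open>c\<close> elsewhere are irrelevant. In particular the conditions are void for a single vertex.
\<close>

definition distance_regular :: "'a set \<Rightarrow> ('a \<times> 'a) set \<Rightarrow> bool" where
  "distance_regular V E \<longleftrightarrow>
     (\<exists>b c :: nat \<Rightarrow> nat.
        (\<forall>i. enat i < graph_diam V E \<longrightarrow> 0 < b i) \<and>
        (\<forall>i. 1 \<le> i \<and> enat i \<le> graph_diam V E \<longrightarrow> 0 < c i) \<and>
        (0 < graph_diam V E \<longrightarrow> (\<forall>v \<in> V. card (sphere_at V E 1 v) = b 0)) \<and>
        (\<forall>i. 1 \<le> i \<and> enat i < graph_diam V E \<longrightarrow>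
           (\<forall>v \<in> V. \<forall>w \<in> V. graph_dist E v w = i \<longrightarrow>
              card (sphere_at V E (i + 1) v \<inter> sphere_at V E 1 w) = b i \<and>
              card (sphere_at V E (i - 1) v \<inter> sphere_at V E 1 w) = c i)) \<and>
        (\<forall>s. 1 \<le> s \<and> graph_diam V E = enat s \<longrightarrow>
           (\<forall>v \<in> V. \<forall>w \<in> V. graph_dist E v w = s \<longrightarrow>
              card (sphere_at V E (s - 1) v \<inter> sphere_at V E 1 w) = c s)))"

definition intersection_number :: "'a set \<Rightarrow> ('a \<times> 'a) set \<Rightarrow> nat \<Rightarrow> nat \<Rightarrow> nat \<Rightarrow> nat" where
  "intersection_number V E i j k =
     (THE n. \<forall>(v, w) \<in> dist_rel V E k.
        finite {u \<in> V. graph_dist E v u = i \<and> graph_dist E u w = j} \<and>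
        card {u \<in> V. graph_dist E v u = i \<and> graph_dist E u w = j} = n)"


section \<open>The convolution of a graph with a base point\<close>

definition walk_coeff :: "'a set \<Rightarrow> ('a \<times> 'a) set \<Rightarrow> 'a \<Rightarrow> nat \<Rightarrow> nat \<Rightarrow> nat \<Rightarrow> real" where
  "walk_coeff V E v\<^sub>0 i j k =
     1 / real (card (sphere_at V E i v\<^sub>0)) *
     (\<Sum>v \<in> sphere_at V E i v\<^sub>0.
        real (card (sphere_at V E j v \<inter> sphere_at V E k v\<^sub>0)) / real (card (sphere_at V E j v)))"

type_synonym 'a rel_space = "('a \<times> 'a) set \<Rightarrow>\<^sub>0 complex"

definition free_scale :: "complex \<Rightarrow> 'a rel_space \<Rightarrow> 'a rel_space" where
  "free_scale a \<mu> = Poly_Mapping.map (\<lambda>x. a * x) \<mu>"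

definition basis_rel :: "'a set \<Rightarrow> ('a \<times> 'a) set \<Rightarrow> nat \<Rightarrow> 'a rel_space" where
  "basis_rel V E i = Poly_Mapping.single (dist_rel V E i) 1"

text \<open>
  The index set may be infinite, and Isabelle's sum over an infinite set is zero, so sums run over
  the indices with nonzero coefficient.
\<close>

definition conv_basis :: "'a set \<Rightarrow> ('a \<times> 'a) set \<Rightarrow> 'a \<Rightarrow> nat \<Rightarrow> nat \<Rightarrow> 'a rel_space" where
  "conv_basis V E v\<^sub>0 i j =
     (\<Sum>k | k \<in> dist_indices V E \<and> walk_coeff V E v\<^sub>0 i j k \<noteq> 0.
        free_scale (of_real (walk_coeff V E v\<^sub>0 i j k)) (basis_rel V E k))"

definition graph_conv ::
  "'a set \<Rightarrow> ('a \<times> 'a) set \<Rightarrow> 'a \<Rightarrow> 'a rel_space \<Rightarrow> 'a rel_space \<Rightarrow> 'a rel_space" where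
  "graph_conv V E v\<^sub>0 \<mu> \<nu> =
     (\<Sum>i | i \<in> dist_indices V E \<and> Poly_Mapping.lookup \<mu> (dist_rel V E i) \<noteq> 0.
      \<Sum>j | j \<in> dist_indices V E \<and> Poly_Mapping.lookup \<nu> (dist_rel V E j) \<noteq> 0.
        free_scale
          (Poly_Mapping.lookup \<mu> (dist_rel V E i) * Poly_Mapping.lookup \<nu> (dist_rel V E j))
          (conv_basis V E v\<^sub>0 i j))"


section \<open>Matrices indexed by vertices\<close>

text \<open>
  A \<open>V \<times> V\<close> matrix is a function that vanishes outside \<open>V \<times> V\<close>; addition is pointwise. For
  the matrices considered here every sum in \<open>mat_prod\<close> has finitely many nonzero terms.
\<close>

type_synonym 'a vmat = "'a \<Rightarrow> 'a \<Rightarrow> complex"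

definition mat_scale :: "complex \<Rightarrow> 'a vmat \<Rightarrow> 'a vmat" where
  "mat_scale a M = (\<lambda>v w. a * M v w)"

definition mat_prod :: "'a set \<Rightarrow> 'a vmat \<Rightarrow> 'a vmat \<Rightarrow> 'a vmat" where
  "mat_prod V M N = (\<lambda>v w. \<Sum>\<^sub>\<infinity>u \<in> V. M v u * N u w)"

definition dist_matrix :: "'a set \<Rightarrow> ('a \<times> 'a) set \<Rightarrow> nat \<Rightarrow> 'a vmat" where
  "dist_matrix V E i = (\<lambda>v w. if v \<in> V \<and> w \<in> V \<and> graph_dist E v w = i then 1 else 0)"

definition normalized_dist_matrix :: "'a set \<Rightarrow> ('a \<times> 'a) set \<Rightarrow> nat \<Rightarrow> 'a vmat" where
  "normalized_dist_matrix V E i =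
     mat_scale (inverse (of_nat (intersection_number V E i i 0))) (dist_matrix V E i)"

end

theory Submission
  imports Defs
begin

text \<open>
  Counting the pairs of adjacent points \<open>(x, u)\<close> with \<open>d v x = i\<close> and \<open>d w u = j\<close> once by \<open>x\<close> and once
  by \<open>u\<close> gives a recursion in \<open>j\<close> for \<open>card (sphere_at V E i v \<inter> sphere_at V E j w)\<close> whose coefficients
  come from the intersection array; hence this number is an intersection number \<open>p i j k\<close> with
  \<open>k = d v w\<close>. With the valencies \<open>n i = p i i 0\<close>, a double count turns the transition probabilities
  of the walk into \<open>P i j k = n k * p i j k / (n i * n j)\<close>, which does not depend on the base point
  and is the structure constant of the normalized distance matrices. All hypergroup axioms then
  reduce to identities for \<open>p\<close>: commutativity is its symmetry in \<open>i, j\<close> and associativity is a count of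
  paths with steps at distances \<open>i, j, k\<close>.
\<close>

section \<open>Hermitian hypergroups from structure constants\<close>

text \<open>The algebra laws used below hold only inside a span, so each induction step must also
  supply membership of the summands in the span.\<close>

lemma (in module) span_induct_closed [consumes 1, case_names zero add scale basis]:
  assumes "x \<in> span S" and "h 0"
    and "\<And>x y. x \<in> span S \<Longrightarrow> y \<in> span S \<Longrightarrow> h x \<Longrightarrow> h y \<Longrightarrow> h (x + y)"
    and "\<And>a x. x \<in> span S \<Longrightarrow> h x \<Longrightarrow> h (a *s x)"
    and "\<And>x. x \<in> S \<Longrightarrow> h x"
  shows "h x"
proof -
  have "subspace {x \<in> span S. h x}"
    using assms by (auto simp: subspace_def span_zero span_add span_scale)
  then have "span S \<subseteq> {x \<in> span S. h x}"
    using assms(5) by (intro span_minimal) (auto intro: span_base)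
  with assms(1) show ?thesis by blast
qed

lemma (in module) representation_eq_span:
  assumes "independent K" "x \<in> span K" "y \<in> span K"
    and "\<And>b. b \<in> K \<Longrightarrow> representation K x b = representation K y b"
  shows "x = y"
proof -
  have eq: "representation K x = representation K y"
  proof
    fix b show "representation K x b = representation K y b"
      using assms(4)[of b] representation_ne_zero[of K x b] representation_ne_zero[of K y b]
      by metis
  qed
  show ?thesis
    using sum_nonzero_representation_eq[OF assms(1,2), unfolded eq]
      sum_nonzero_representation_eq[OF assms(1,3)]
    by (rule trans[OF sym])
qed

text \<open>The maps \<open>f k\<close> act as coordinates dual to the family \<open>B\<close>:
  applying \<open>f k\<close> to a linear relation isolates the coefficient of
  \<open>B k\<close>.\<close>

lemma (in module) independent_familyI:
  fixes f :: "'i \<Rightarrow> 'b \<Rightarrow> 'a" and B :: "'i \<Rightarrow> 'b"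
  assumes add: "\<And>k x y. k \<in> I \<Longrightarrow> f k (x + y) = f k x + f k y"
    and scale: "\<And>k a x. k \<in> I \<Longrightarrow> f k (a *s x) = a * f k x"
    and diag: "\<And>k. k \<in> I \<Longrightarrow> f k (B k) = 1"
    and off: "\<And>k l. k \<in> I \<Longrightarrow> l \<in> I \<Longrightarrow> k \<noteq> l \<Longrightarrow> f k (B l) = 0"
    and nontriv: "(1::'a) \<noteq> 0"
  shows "inj_on B I" "independent (B ` I)"
proof -
  show inj: "inj_on B I"
    using diag off nontriv by (metis inj_onI)
  show "independent (B ` I)"
    unfolding dependent_explicit
  proof (safe)
    fix t :: "'b set" and u b
    assume t: "finite t" "t \<subseteq> B ` I" "(\<Sum>v\<in>t. u v *s v) = 0"
      and b: "b \<in> t" "u b \<noteq> 0"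
    from t(2) b(1) obtain k where k: "k \<in> I" "B k = b" by auto
    have f0: "f k 0 = 0" using add[OF k(1), of 0 0] by simp
    have "f k (\<Sum>v\<in>t. u v *s v) = (\<Sum>v\<in>t. u v * f k v)"
      using t(1) by (induction t) (auto simp: add scale f0 k(1))
    also have "\<dots> = (\<Sum>v\<in>t. if v = B k then u v else 0)"
    proof (intro sum.cong refl)
      fix x assume "x \<in> t"
      then obtain l where "l \<in> I" "x = B l" using t(2) by auto
      then show "u x * f k x = (if x = B k then u x else 0)"
        using diag[OF k(1)] off[OF k(1), of l] by (cases "l = k") auto
    qed
    also have "\<dots> = u (B k)"
      using t(1) b(1) k(2) by (simp add: sum.delta)
    finally show False using t(3) f0 b(2) k(2) by simp
  qed
qed

section \<open>Conjugation of coefficients with respect to a basis\<close>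

locale complex_basis = vector_space smul
  for smul :: "complex \<Rightarrow> 'b::ab_group_add \<Rightarrow> 'b" (infixr "*s" 75) +
  fixes K :: "'b set"
  assumes indep: "independent K"
begin

abbreviation "rep \<equiv> representation K"
abbreviation "bar \<equiv> conj_fixing smul K"

lemma hg_supp_eq: "hg_supp smul K \<mu> = {x. rep \<mu> x \<noteq> 0}"
  using representation_ne_zero by (auto simp: hg_supp_def)

lemma bar_in_span: "bar \<mu> \<in> span K"
  unfolding conj_fixing_def by (intro span_sum span_scale span_base) (simp add: hg_supp_def)

text \<open>The sum defining \<open>conj_fixing\<close> is already a basis expansion, so its
  coefficients can be read off; the laws of the involution then follow coefficientwise.\<close>

lemma rep_bar: "rep (bar \<mu>) = (\<lambda>x. cnj (rep \<mu> x))"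
proof (rule representation_eqI[OF indep bar_in_span])
  show "finite {b. cnj (rep \<mu> b) \<noteq> 0}"
    using finite_representation by simp
  show "(\<Sum>b | cnj (rep \<mu> b) \<noteq> 0. cnj (rep \<mu> b) *s b) = bar \<mu>"
    by (simp add: conj_fixing_def hg_supp_eq)
qed (use representation_ne_zero in auto)

lemma bar_add: "x \<in> span K \<Longrightarrow> y \<in> span K \<Longrightarrow> bar (x + y) = bar x + bar y"
  by (rule representation_eq_span[OF indep])
    (auto simp: bar_in_span span_add rep_bar representation_add indep)

lemma bar_scale: "x \<in> span K \<Longrightarrow> bar (a *s x) = cnj a *s bar x"
  by (rule representation_eq_span[OF indep])
    (auto simp: bar_in_span span_scale rep_bar representation_scale indep)

lemma bar_bar: "x \<in> span K \<Longrightarrow> bar (bar x) = x"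
  by (rule representation_eq_span[OF indep]) (auto simp: bar_in_span rep_bar)

lemma bar_basis: "x \<in> K \<Longrightarrow> bar x = x"
  by (rule representation_eq_span[OF indep])
    (auto simp: bar_in_span span_base rep_bar representation_basis indep)

lemma bar_zero: "bar 0 = 0"
  by (simp add: conj_fixing_def hg_supp_eq representation_zero)

end

text \<open>These are the hypergroup axioms in terms of structure constants. As the constants are
  real, \<open>commute\<close> expresses anti-multiplicativity of an involution that fixes the
  basis.\<close>

locale hermitian_coeffs =
  fixes I :: "'i set" and P :: "'i \<Rightarrow> 'i \<Rightarrow> 'i \<Rightarrow> real" and e :: 'i
  assumes unit_in: "e \<in> I"
    and finite_supp: "i \<in> I \<Longrightarrow> j \<in> I \<Longrightarrow> finite {k \<in> I. P i j k \<noteq> 0}"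
    and nonneg: "i \<in> I \<Longrightarrow> j \<in> I \<Longrightarrow> k \<in> I \<Longrightarrow> P i j k \<ge> 0"
    and sum_one: "i \<in> I \<Longrightarrow> j \<in> I \<Longrightarrow> (\<Sum>k | k \<in> I \<and> P i j k \<noteq> 0. P i j k) = 1"
    and commute: "i \<in> I \<Longrightarrow> j \<in> I \<Longrightarrow> k \<in> I \<Longrightarrow> P i j k = P j i k"
    and assoc: "i \<in> I \<Longrightarrow> j \<in> I \<Longrightarrow> k \<in> I \<Longrightarrow> m \<in> I \<Longrightarrow>
      (\<Sum>l | l \<in> I \<and> P i j l \<noteq> 0. P i j l * P l k m) =
      (\<Sum>l | l \<in> I \<and> P j k l \<noteq> 0. P j k l * P i l m)"
    and unit_left: "j \<in> I \<Longrightarrow> k \<in> I \<Longrightarrow> P e j k = (if j = k then 1 else 0)"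
    and unit_supp: "i \<in> I \<Longrightarrow> j \<in> I \<Longrightarrow> P i j e \<noteq> 0 \<longleftrightarrow> i = j"

text \<open>Bilinearity is assumed only on the span because a product of arbitrary matrices involves
  infinite sums that may diverge.\<close>

locale hermitian_basis = vector_space smul + hermitian_coeffs I P e
  for smul :: "complex \<Rightarrow> 'b::ab_group_add \<Rightarrow> 'b" (infixr "*s" 75)
    and I :: "'i set" and P and e +
  fixes B :: "'i \<Rightarrow> 'b" and conv :: "'b \<Rightarrow> 'b \<Rightarrow> 'b" (infixl "\<star>" 70)
  assumes inj_B: "inj_on B I"
    and indep_B: "independent (B ` I)"
    and conv_B: "i \<in> I \<Longrightarrow> j \<in> I \<Longrightarrow>
      B i \<star> B j = (\<Sum>k | k \<in> I \<and> P i j k \<noteq> 0. of_real (P i j k) *s B k)"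
    and add_left: "x \<in> span (B ` I) \<Longrightarrow> y \<in> span (B ` I) \<Longrightarrow> z \<in> span (B ` I) \<Longrightarrow>
      (x + y) \<star> z = x \<star> z + y \<star> z"
    and add_right: "x \<in> span (B ` I) \<Longrightarrow> y \<in> span (B ` I) \<Longrightarrow> z \<in> span (B ` I) \<Longrightarrow>
      x \<star> (y + z) = x \<star> y + x \<star> z"
    and scale_left: "x \<in> span (B ` I) \<Longrightarrow> y \<in> span (B ` I) \<Longrightarrow> (a *s x) \<star> y = a *s (x \<star> y)"
    and scale_right: "x \<in> span (B ` I) \<Longrightarrow> y \<in> span (B ` I) \<Longrightarrow> x \<star> (a *s y) = a *s (x \<star> y)"

sublocale hermitian_basis \<subseteq> complex_basis smul "B ` I"
  by unfold_locales (rule indep_B)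

context hermitian_basis
begin

abbreviation "A \<equiv> span (B ` I)"

lemma B_in: "i \<in> I \<Longrightarrow> B i \<in> A"
  by (simp add: span_base)

lemma zero_left: "y \<in> A \<Longrightarrow> 0 \<star> y = 0"
  using scale_left[of 0 y 0] by (simp add: span_zero)

lemma zero_right: "y \<in> A \<Longrightarrow> y \<star> 0 = 0"
  using scale_right[of y 0 0] by (simp add: span_zero)

lemma sum_left: "(\<And>i. i \<in> S \<Longrightarrow> f i \<in> A) \<Longrightarrow> y \<in> A \<Longrightarrow> sum f S \<star> y = (\<Sum>i\<in>S. f i \<star> y)"
  by (induction S rule: infinite_finite_induct) (auto simp: zero_left add_left span_sum)

lemma sum_right: "(\<And>i. i \<in> S \<Longrightarrow> f i \<in> A) \<Longrightarrow> y \<in> A \<Longrightarrow> y \<star> sum f S = (\<Sum>i\<in>S. y \<star> f i)"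
  by (induction S rule: infinite_finite_induct) (auto simp: zero_right add_right span_sum)

lemma conv_B_in: "i \<in> I \<Longrightarrow> j \<in> I \<Longrightarrow> B i \<star> B j \<in> A"
  by (auto simp: conv_B intro!: span_sum span_scale B_in)

lemma conv_in: "x \<in> A \<Longrightarrow> y \<in> A \<Longrightarrow> x \<star> y \<in> A"
proof (induction x rule: span_induct_closed)
  case (basis x)
  from basis(2) show ?case
    by (induction y rule: span_induct_closed)
      (use basis(1) in \<open>auto simp: zero_right add_right scale_right span_zero span_add span_scale
        conv_B_in B_in\<close>)
qed (auto simp: zero_left add_left scale_left span_zero span_add span_scale)

text \<open>Injectivity of \<open>B\<close> lets the expansion collapse to the index
  \<open>k\<close>; if \<open>P i j k\<close> is zero, this index is missing from the sum and both
  sides vanish.\<close>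

lemma rep_conv_B:
  assumes "i \<in> I" "j \<in> I" "k \<in> I"
  shows "rep (B i \<star> B j) (B k) = of_real (P i j k)"
proof -
  have "rep (B i \<star> B j) (B k) =
      (\<Sum>l | l \<in> I \<and> P i j l \<noteq> 0. of_real (P i j l) * rep (B l) (B k))"
    unfolding conv_B[OF assms(1,2)]
    by (subst representation_sum[OF indep_B])
      (auto simp: representation_scale[OF indep_B] B_in intro!: span_scale)
  also have "\<dots> = (\<Sum>l | l \<in> I \<and> P i j l \<noteq> 0. if l = k then of_real (P i j l) else 0)"
    by (intro sum.cong) (auto simp: representation_basis[OF indep_B] inj_on_eq_iff[OF inj_B] assms)
  also have "\<dots> = of_real (P i j k)"
    using finite_supp assms by (auto simp: sum.delta)
  finally show ?thesis .
qed

text \<open>Symmetry of \<open>P i j k\<close> in \<open>i\<close> and \<open>j\<close>, extended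
  bilinearly. It serves both the right unit law and anti-multiplicativity of the involution.\<close>

lemma conv_commute: "x \<in> A \<Longrightarrow> y \<in> A \<Longrightarrow> x \<star> y = y \<star> x"
proof (induction x rule: span_induct_closed)
  case (basis x)
  from basis(2) show ?case
  proof (induction y rule: span_induct_closed)
    case (basis y)
    with \<open>x \<in> B ` I\<close> obtain i j where "x = B i" "y = B j" "i \<in> I" "j \<in> I" by auto
    moreover have "rep (B i \<star> B j) b = rep (B j \<star> B i) b" if "b \<in> B ` I" for b
      using that \<open>i \<in> I\<close> \<open>j \<in> I\<close> by (auto simp: rep_conv_B commute)
    ultimately show ?case
      by (auto intro: representation_eq_span[OF indep_B] conv_B_in)
  qed (use basis(1) in \<open>auto simp: zero_right add_right scale_right zero_left add_left scale_left
        span_base\<close>)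
qed (auto simp: zero_left add_left scale_left zero_right add_right scale_right)

lemma conv_assoc_B:
  assumes "i \<in> I" "j \<in> I" "k \<in> I"
  shows "(B i \<star> B j) \<star> B k = B i \<star> (B j \<star> B k)"
proof (rule representation_eq_span[OF indep_B])
  fix b assume "b \<in> B ` I"
  then obtain m where m: "m \<in> I" "b = B m" by auto
  have "rep ((B i \<star> B j) \<star> B k) b =
      of_real (\<Sum>l | l \<in> I \<and> P i j l \<noteq> 0. P i j l * P l k m)"
    unfolding conv_B[OF assms(1,2)]
    by (subst sum_left, (auto intro!: span_scale B_in assms)[2], subst representation_sum[OF indep_B])
      (auto simp: scale_left B_in assms m representation_scale[OF indep_B] conv_B_in rep_conv_B
        intro!: span_scale)
  also have "\<dots> = of_real (\<Sum>l | l \<in> I \<and> P j k l \<noteq> 0. P j k l * P i l m)"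
    using assoc assms m by simp
  also have "\<dots> = rep (B i \<star> (B j \<star> B k)) b"
    unfolding conv_B[OF assms(2,3)]
    by (subst sum_right, (auto intro!: span_scale B_in assms)[2], subst representation_sum[OF indep_B])
      (auto simp: scale_right B_in assms m representation_scale[OF indep_B] conv_B_in rep_conv_B
        intro!: span_scale)
  finally show "rep ((B i \<star> B j) \<star> B k) b = rep (B i \<star> (B j \<star> B k)) b" .
qed (use assms in \<open>auto intro!: conv_in B_in\<close>)

lemma conv_assoc: "x \<in> A \<Longrightarrow> y \<in> A \<Longrightarrow> z \<in> A \<Longrightarrow> (x \<star> y) \<star> z = x \<star> (y \<star> z)"
proof (induction x rule: span_induct_closed)
  case (basis x)
  from basis(2) basis(1,3) show ?case
  proof (induction y rule: span_induct_closed)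
    case (basis y)
    from basis(3) basis(1,2) show ?case
    proof (induction z rule: span_induct_closed)
      case (basis z)
      then show ?case using conv_assoc_B by auto
    qed (auto simp: zero_right add_right scale_right span_base conv_in)
  qed (auto simp: zero_right add_right scale_right zero_left add_left scale_left span_base conv_in)
qed (auto simp: zero_left add_left scale_left conv_in)

text \<open>Products of basis elements have real coefficients, so conjugation fixes them.\<close>

lemma bar_conv_B:
  assumes "i \<in> I" "j \<in> I"
  shows "bar (B i \<star> B j) = B i \<star> B j"
  by (rule representation_eq_span[OF indep_B])
    (use assms in \<open>auto simp: bar_in_span conv_B_in rep_bar rep_conv_B\<close>)

lemma bar_conv: "x \<in> A \<Longrightarrow> y \<in> A \<Longrightarrow> bar (x \<star> y) = bar x \<star> bar y"
proof (induction x rule: span_induct_closed)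
  case (basis x)
  from basis(2,1) show ?case
  proof (induction y rule: span_induct_closed)
    case (basis y)
    then show ?case using bar_conv_B by (auto simp: bar_basis)
  qed (auto simp: zero_right add_right scale_right bar_zero bar_add bar_scale bar_in_span conv_in
        span_base)
qed (auto simp: zero_left add_left scale_left bar_zero bar_add bar_scale bar_in_span conv_in)

lemma unit_conv: "x \<in> A \<Longrightarrow> B e \<star> x = x"
proof (induction x rule: span_induct_closed)
  case (basis x)
  then obtain j where j: "j \<in> I" "x = B j" by auto
  have "rep (B e \<star> B j) b = rep (B j) b" if "b \<in> B ` I" for b
    using that j
    by (auto simp: rep_conv_B unit_in unit_left representation_basis[OF indep_B]
        inj_on_eq_iff[OF inj_B])
  then show ?case
    using j by (auto intro: representation_eq_span[OF indep_B] conv_B_in B_in unit_in)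
qed (auto simp: zero_right add_right scale_right B_in unit_in)

theorem hermitian_discrete_hypergroup:
  "hermitian_discrete_hypergroup smul (B ` I) (\<star>) bar"
proof -
  have supp: "hg_supp smul (B ` I) (B i \<star> B j) = B ` {k \<in> I. P i j k \<noteq> 0}"
    if "i \<in> I" "j \<in> I" for i j
    using that by (auto simp: hg_supp_def rep_conv_B)
  have "star_algebra_on smul A (\<star>) bar"
    \<comment> \<open>\<open>bar_conv\<close> keeps the order of the factors; commutativity reverses
      it, as \<open>star_conv\<close> demands.\<close>
    by unfold_locales
      (auto simp: subspace_span conv_in add_left add_right scale_left scale_right conv_assoc
        bar_in_span bar_add bar_scale bar_bar bar_conv conv_commute[OF bar_in_span bar_in_span])
  moreover have "B e \<star> \<mu> = \<mu> \<and> \<mu> \<star> B e = \<mu>" if "\<mu> \<in> A" for \<mu>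
    using unit_conv conv_commute that by (simp add: B_in unit_in)
  moreover have "rep (x \<star> y) z \<in> \<real>\<^sub>\<ge>\<^sub>0" if "x \<in> B ` I" "y \<in> B ` I" "z \<in> B ` I" for x y z
    using that nonneg by (auto simp: rep_conv_B complex_nonneg_Reals_iff)
  moreover have "hg_norm1 smul (B ` I) (x \<star> y) = 1" if xy: "x \<in> B ` I" "y \<in> B ` I" for x y
  proof -
    obtain i j where ij: "x = B i" "y = B j" "i \<in> I" "j \<in> I" using xy by auto
    have "hg_norm1 smul (B ` I) (x \<star> y) = (\<Sum>k | k \<in> I \<and> P i j k \<noteq> 0. cmod (rep (x \<star> y) (B k)))"
      unfolding hg_norm1_def ij(1,2) supp[OF ij(3,4)]
      using inj_B by (subst sum.reindex) (auto intro: inj_on_subset)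
    \<comment> \<open>Nonnegativity replaces each modulus by the coefficient itself, so the norm is
      a row sum of \<open>P\<close>.\<close>
    also have "\<dots> = (\<Sum>k | k \<in> I \<and> P i j k \<noteq> 0. P i j k)"
      using ij nonneg by (intro sum.cong) (auto simp: rep_conv_B)
    finally show ?thesis using sum_one ij by simp
  qed
  moreover have "B e \<in> hg_supp smul (B ` I) (x \<star> y) \<longleftrightarrow> y = bar x"
    if xy: "x \<in> B ` I" "y \<in> B ` I" for x y
  proof -
    obtain i j where ij: "x = B i" "y = B j" "i \<in> I" "j \<in> I" using xy by auto
    have "B e \<in> hg_supp smul (B ` I) (x \<star> y) \<longleftrightarrow> P i j e \<noteq> 0"
      using ij inj_B unit_in by (simp add: hg_supp_def rep_conv_B)
    then show ?thesis
      using ij xy(1) unit_supp by (auto simp: bar_basis inj_on_eq_iff[OF inj_B])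
  qed
  ultimately show ?thesis
    unfolding hermitian_discrete_hypergroup_def discrete_hypergroup_def
    using vector_space_axioms indep_B unit_in
    by (intro conjI bexI[of _ "B e"]) (simp_all add: bar_basis)
qed

end

text \<open>A linear map carrying one independent family bijectively to another is injective on the
  span. It is multiplicative because products of basis elements have the same coefficients on both
  sides.\<close>

lemma hypergroup_iso_of_same_coeffs:
  assumes "hermitian_basis smul I P e B conv" and "hermitian_basis smul' I P e B' conv'"
  shows "\<exists>\<phi>. hypergroup_iso smul (B ` I) conv (conj_fixing smul (B ` I))
      smul' (B' ` I) conv' (conj_fixing smul' (B' ` I)) \<phi> \<and> (\<forall>i \<in> I. \<phi> (B i) = B' i)"
proof -
  interpret b1: hermitian_basis smul I P e B conv by fact
  interpret b2: hermitian_basis smul' I P e B' conv' by fact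
  interpret vector_space_pair smul smul' by unfold_locales
  \<comment> \<open>\<open>inv_into I B\<close> recovers the index of a basis vector, so the
    prescribed map sends \<open>B i\<close> to \<open>B' i\<close>.\<close>
  obtain \<phi> where lin: "Vector_Spaces.linear smul smul' \<phi>" and on: "\<forall>x\<in>B ` I. \<phi> x = B' (inv_into I B x)"
    using linear_independent_extend[OF b1.indep_B, of "\<lambda>x. B' (inv_into I B x)"] by blast
  have val: "\<phi> (B i) = B' i" if "i \<in> I" for i
    using on that by (simp add: inv_into_f_f[OF b1.inj_B])
  have img: "\<phi> ` (B ` I) = B' ` I"
    unfolding image_image using val by simp
  interpret \<phi>: Vector_Spaces.linear smul smul' \<phi> by (rule lin)
  have inj: "inj_on \<phi> (B ` I)"
    using val b1.inj_B b2.inj_B by (auto simp: inj_on_def)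
  have "inj_on \<phi> b1.A"
    by (rule \<phi>.inj_on_span_independent_image) (simp_all add: img b2.indep_B inj)
  then have bij: "bij_betw \<phi> b1.A b2.A"
    using \<phi>.span_image[of "B ` I"] by (simp add: bij_betw_def img)
  have mem: "\<phi> x \<in> b2.A" if "x \<in> b1.A" for x
    using bij that by (auto simp: bij_betw_def)
  have conv: "\<phi> (conv x y) = conv' (\<phi> x) (\<phi> y)" if "x \<in> b1.A" "y \<in> b1.A" for x y
    using that
  proof (induction x rule: b1.span_induct_closed)
    case (basis x)
    from basis(2,1) show ?case
    proof (induction y rule: b1.span_induct_closed)
      case (basis y)
      then show ?case
        by (auto simp: val b1.conv_B b2.conv_B \<phi>.sum \<phi>.scale)
    qed (auto simp: b1.zero_right b1.add_right b1.scale_right b2.zero_right b2.add_right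
        b2.scale_right \<phi>.zero \<phi>.add \<phi>.scale mem b1.span_base)
  qed (auto simp: b1.zero_left b1.add_left b1.scale_left b2.zero_left b2.add_left
        b2.scale_left \<phi>.zero \<phi>.add \<phi>.scale mem)
  have bar: "\<phi> (b1.bar x) = b2.bar (\<phi> x)" if "x \<in> b1.A" for x
    using that
    by (induction x rule: b1.span_induct_closed)
      (auto simp: b1.bar_zero b1.bar_add b1.bar_scale b2.bar_zero b2.bar_add b2.bar_scale
        \<phi>.zero \<phi>.add \<phi>.scale mem b1.bar_basis b2.bar_basis val)
  have "bij_betw \<phi> (B ` I) (B' ` I)"
    using inj img by (simp add: bij_betw_def)
  with bij conv bar val show ?thesis
    unfolding hypergroup_iso_def by (intro exI[of _ \<phi>]) (auto simp: \<phi>.add \<phi>.scale)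
qed

section \<open>Spheres in a distance-regular graph\<close>

locale locally_finite_graph =
  fixes V :: "'a set" and E :: "('a \<times> 'a) set"
  assumes simple: "simple_graph V E"
    and connected: "connected_graph V E"
    and finite_degrees: "finite_degrees V E"
begin

abbreviation "d \<equiv> graph_dist E"
abbreviation "G \<equiv> sphere_at V E"
abbreviation "I \<equiv> dist_indices V E"

lemma sym_relpow: "(v, w) \<in> E ^^ n \<Longrightarrow> (w, v) \<in> E ^^ n"
  using simple
proof (induction n arbitrary: v w)
  case (Suc n)
  then obtain u where "(v, u) \<in> E ^^ n" "(u, w) \<in> E" by auto
  then have "(u, v) \<in> E ^^ n" "(w, u) \<in> E"
    using Suc by (auto simp: simple_graph_def sym_def)
  then show ?case by (rule relpow_Suc_I2[rotated])
qed simp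

lemma relpow_dist: "v \<in> V \<Longrightarrow> w \<in> V \<Longrightarrow> (v, w) \<in> E ^^ d v w"
  unfolding graph_dist_def using connected
  by (metis LeastI_ex connected_graph_def rtrancl_imp_relpow)

lemma dist_le: "(v, w) \<in> E ^^ n \<Longrightarrow> d v w \<le> n"
  unfolding graph_dist_def by (rule Least_le)

lemma dist_self [simp]: "d v v = 0"
  using dist_le[of v v 0] by simp

lemma dist_eq_0: "v \<in> V \<Longrightarrow> w \<in> V \<Longrightarrow> d v w = 0 \<longleftrightarrow> v = w"
  using relpow_dist[of v w] by auto

lemma dist_sym: "d v w = d w v"
  unfolding graph_dist_def using sym_relpow by (metis (lifting))

lemma dist_triangle:
  assumes "v \<in> V" "u \<in> V" "w \<in> V"
  shows "d v w \<le> d v u + d u w"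
proof (rule dist_le)
  show "(v, w) \<in> E ^^ (d v u + d u w)"
    using relpow_dist assms by (auto simp: relpow_add)
qed

lemma edge_dist: "(v, w) \<in> E \<Longrightarrow> d v w = 1"
proof -
  assume e: "(v, w) \<in> E"
  then have "v \<in> V" "w \<in> V" "v \<noteq> w"
    using simple by (auto simp: simple_graph_def irrefl_def)
  moreover have "d v w \<le> 1" using e by (intro dist_le) auto
  ultimately show ?thesis using dist_eq_0[of v w] by linarith
qed

text \<open>The last vertex before \<open>w\<close> on a shortest walk is one step closer to
  \<open>v\<close>; the triangle inequality keeps it from being closer still.\<close>

lemma dist_Suc_split:
  assumes "v \<in> V" "w \<in> V" "d v w = Suc n"
  obtains u where "u \<in> V" "d v u = n" "(u, w) \<in> E"
proof -
  from relpow_dist[OF assms(1,2)] obtain u where u: "(v, u) \<in> E ^^ n" "(u, w) \<in> E"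
    unfolding assms(3) by auto
  then have "u \<in> V" using simple by (auto simp: simple_graph_def)
  moreover have "d v u \<le> n" using u(1) by (rule dist_le)
  moreover have "Suc n \<le> d v u + 1"
    using dist_triangle[OF assms(1) \<open>u \<in> V\<close> assms(2)] edge_dist[OF u(2)] assms(3) by simp
  ultimately show ?thesis using that u(2) by force
qed

lemma sphere_0: "v \<in> V \<Longrightarrow> G 0 v = {v}"
  using dist_eq_0 by (auto simp: sphere_at_def)

lemma in_sphere: "w \<in> G i v \<longleftrightarrow> w \<in> V \<and> d v w = i"
  by (simp add: sphere_at_def)

lemma finite_sphere: "v \<in> V \<Longrightarrow> finite (G i v)"
proof (induction i)
  case (Suc i)
  have "G (Suc i) v \<subseteq> (\<Union>u\<in>G i v. {w \<in> V. (u, w) \<in> E})"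
  proof
    fix w assume "w \<in> G (Suc i) v"
    then have w: "w \<in> V" "d v w = Suc i" by (simp_all add: in_sphere)
    obtain u where "u \<in> V" "d v u = i" "(u, w) \<in> E"
      using dist_Suc_split[OF Suc.prems w] .
    with w show "w \<in> (\<Union>u\<in>G i v. {w \<in> V. (u, w) \<in> E})" by (auto simp: in_sphere)
  qed
  moreover have "finite (\<Union>u\<in>G i v. {w \<in> V. (u, w) \<in> E})"
    using Suc.IH[OF Suc.prems] finite_degrees unfolding finite_degrees_def
    by (intro finite_UN_I) (simp_all add: in_sphere)
  ultimately show ?case by (rule finite_subset)
qed (simp add: sphere_0)

lemma dist_le_diam: "v \<in> V \<Longrightarrow> w \<in> V \<Longrightarrow> enat (d v w) \<le> graph_diam V E"
  unfolding graph_diam_def by (meson SUP_upper2 order_refl)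

lemma dist_in_I: "v \<in> V \<Longrightarrow> w \<in> V \<Longrightarrow> d v w \<in> I"
  by (simp add: dist_indices_def dist_le_diam)

lemma sphere_disjoint_I: "v \<in> V \<Longrightarrow> i \<notin> I \<Longrightarrow> G i v = {}"
  using dist_in_I by (auto simp: in_sphere)

lemma dist_neighbour:
  assumes "v \<in> V" "u \<in> V" "w \<in> V" "d u w = 1"
  shows "d v w = d v u \<or> d v w = Suc (d v u) \<or> d v u = Suc (d v w)"
  using dist_triangle[of v u w] dist_triangle[of v w u] assms by (auto simp: dist_sym[of w u])

text \<open>Double counting of the pairs \<open>(x, u)\<close> with \<open>x \<in> G i v\<close>, \<open>u \<in> G j w\<close> at distance \<open>k\<close>.\<close>

lemma sphere_double_count:
  assumes "v \<in> V" "w \<in> V"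
  shows "(\<Sum>x\<in>G i v. card (G j w \<inter> G k x)) = (\<Sum>u\<in>G j w. card (G i v \<inter> G k u))"
proof -
  have "(\<Sum>x\<in>G i v. card (G j w \<inter> G k x)) = (\<Sum>x\<in>G i v. \<Sum>u\<in>G j w. if d x u = k then 1 else 0)"
    using finite_sphere[OF assms(2)]
    by (intro sum.cong refl) (auto simp: sum.If_cases in_sphere intro!: arg_cong[of _ _ card])
  also have "\<dots> = (\<Sum>u\<in>G j w. \<Sum>x\<in>G i v. if d x u = k then 1 else 0)"
    by (rule sum.swap)
  also have "\<dots> = (\<Sum>u\<in>G j w. card (G i v \<inter> G k u))"
    using finite_sphere[OF assms(1)]
    by (intro sum.cong refl)
      (auto simp: sum.If_cases in_sphere dist_sym intro!: arg_cong[of _ _ card])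
  finally show ?thesis .
qed

text \<open>The sum is grouped by the distance of \<open>x\<close> from \<open>w\<close>. Since
  \<open>S\<close> may contain further distances, whose fibres are empty, later sums can share a
  convenient range.\<close>

lemma sum_sphere_by_dist:
  fixes f :: "nat \<Rightarrow> 'c::comm_semiring_1"
  assumes "v \<in> V" "finite S" "(\<lambda>x. d w x) ` G i v \<subseteq> S"
  shows "(\<Sum>x\<in>G i v. f (d w x)) = (\<Sum>h\<in>S. f h * of_nat (card (G i v \<inter> G h w)))"
proof -
  have "(\<Sum>x\<in>G i v. f (d w x)) = (\<Sum>h\<in>S. \<Sum>x | x \<in> G i v \<and> d w x = h. f (d w x))"
    using assms finite_sphere by (intro sum.group[symmetric]) auto
  also have "\<dots> = (\<Sum>h\<in>S. f h * of_nat (card (G i v \<inter> G h w)))"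
  proof (intro sum.cong refl)
    fix h
    have "{x. x \<in> G i v \<and> d w x = h} = G i v \<inter> G h w" by (auto simp: in_sphere)
    then show "(\<Sum>x | x \<in> G i v \<and> d w x = h. f (d w x)) = f h * of_nat (card (G i v \<inter> G h w))"
      by (simp add: in_sphere mult.commute)
  qed
  finally show ?thesis .
qed

text \<open>Comparing pairs of points leaves distances that do not occur unconstrained.\<close>

definition dist_invariant :: "('a \<Rightarrow> 'a \<Rightarrow> nat) \<Rightarrow> bool" where
  "dist_invariant F \<longleftrightarrow>
    (\<forall>v\<in>V. \<forall>w\<in>V. \<forall>v'\<in>V. \<forall>w'\<in>V. d v w = d v' w' \<longrightarrow> F v w = F v' w')"

lemma dist_invariantD:
  "dist_invariant F \<Longrightarrow> v \<in> V \<Longrightarrow> w \<in> V \<Longrightarrow> v' \<in> V \<Longrightarrow> w' \<in> V \<Longrightarrow> d v w = d v' w' \<Longrightarrow> F v w = F v' w'"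
  unfolding dist_invariant_def by blast

lemma dist_invariant_fun:
  assumes "dist_invariant F"
  obtains f where "\<And>v w. v \<in> V \<Longrightarrow> w \<in> V \<Longrightarrow> F v w = f (d v w)"
proof -
  have "\<exists>f. \<forall>n. \<forall>v\<in>V. \<forall>w\<in>V. d v w = n \<longrightarrow> F v w = f n"
  proof (rule choice, rule allI)
    fix n
    show "\<exists>m. \<forall>v\<in>V. \<forall>w\<in>V. d v w = n \<longrightarrow> F v w = m"
    proof (cases "\<exists>v\<in>V. \<exists>w\<in>V. d v w = n")
      case True
      then obtain v w where "v \<in> V" "w \<in> V" "d v w = n" by blast
      then show ?thesis
        by (intro exI[of _ "F v w"] ballI impI dist_invariantD[OF assms]) simp_all
    qed blast
  qed
  then obtain f where f: "\<forall>n. \<forall>v\<in>V. \<forall>w\<in>V. d v w = n \<longrightarrow> F v w = f n" ..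
  show thesis by (rule that[of f]) (use f in simp)
qed

end

section \<open>From the intersection array to distance-invariant sphere intersections\<close>

locale distance_regular_graph = locally_finite_graph +
  assumes regular: "distance_regular V E"
begin

text \<open>The definition treats the valency, the interior indices and the last index separately;
  merging them gives laws valid at every distance that occurs.\<close>

lemma intersection_array:
  obtains b c :: "nat \<Rightarrow> nat" where
    "\<And>i v w. v \<in> V \<Longrightarrow> w \<in> V \<Longrightarrow> d v w = i \<Longrightarrow> card (G (Suc i) v \<inter> G 1 w) = b i"
    "\<And>i v w. v \<in> V \<Longrightarrow> w \<in> V \<Longrightarrow> d v w = Suc i \<Longrightarrow> card (G i v \<inter> G 1 w) = c (Suc i)"
    "\<And>i. Suc i \<in> I \<Longrightarrow> b i > 0"
proof -
  let ?D = "graph_diam V E"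
  from regular obtain b c :: "nat \<Rightarrow> nat" where
    b: "\<And>i. enat i < ?D \<Longrightarrow> b i > 0" and
    b0: "\<And>v. 0 < ?D \<Longrightarrow> v \<in> V \<Longrightarrow> card (G 1 v) = b 0" and
    bi: "\<And>i v w. 1 \<le> i \<Longrightarrow> enat i < ?D \<Longrightarrow> v \<in> V \<Longrightarrow> w \<in> V \<Longrightarrow> d v w = i \<Longrightarrow>
      card (G (i + 1) v \<inter> G 1 w) = b i" and
    ci: "\<And>i v w. 1 \<le> i \<Longrightarrow> enat i < ?D \<Longrightarrow> v \<in> V \<Longrightarrow> w \<in> V \<Longrightarrow> d v w = i \<Longrightarrow>
      card (G (i - 1) v \<inter> G 1 w) = c i" and
    cs: "\<And>s v w. 1 \<le> s \<Longrightarrow> ?D = enat s \<Longrightarrow> v \<in> V \<Longrightarrow> w \<in> V \<Longrightarrow> d v w = s \<Longrightarrow>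
      card (G (s - 1) v \<inter> G 1 w) = c s"
    unfolding distance_regular_def by (elim exE conjE) (rule that, simp_all)
  \<comment> \<open>At or beyond the diameter the sphere of radius \<open>Suc i\<close> is empty, so
    \<open>b\<close> is replaced by zero there.\<close>
  let ?b = "\<lambda>i. if enat i < ?D then b i else 0"
  show thesis
  proof (rule that[of ?b c])
    fix i v w assume vw: "v \<in> V" "w \<in> V" "d v w = i"
    show "card (G (Suc i) v \<inter> G 1 w) = ?b i"
    proof (cases "enat i < ?D")
      case True
      show ?thesis
      proof (cases "i = 0")
        case True
        then show ?thesis using vw \<open>enat i < ?D\<close> b0[of v] dist_eq_0[of v w] by (auto simp: zero_enat_def)
      qed (use True vw bi in auto)
    next
      case False
      then have "Suc i \<notin> I"
        by (auto simp: dist_indices_def Suc_ile_eq)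
      then show ?thesis using False vw sphere_disjoint_I by auto
    qed
  next
    fix i v w assume vw: "v \<in> V" "w \<in> V" "d v w = Suc i"
    have "enat (Suc i) \<le> ?D" using dist_le_diam vw by metis
    then show "card (G i v \<inter> G 1 w) = c (Suc i)"
      using ci[of "Suc i" v w] cs[of "Suc i" v w] vw by (cases "enat (Suc i) = ?D") auto
  next
    fix i assume "Suc i \<in> I"
    then show "?b i > 0"
      using b by (auto simp: dist_indices_def Suc_ile_eq)
  qed
qed

text \<open>With \<open>h = d w x\<close>, the neighbours of \<open>x\<close> lie at distance
  \<open>h - 1\<close>, \<open>h\<close> or \<open>h + 1\<close> from \<open>w\<close>. The array
  fixes the outer two counts, and the middle one is what remains of the valency
  \<open>b 0\<close>.\<close>

lemma dist_invariant_neighbours: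
  "dist_invariant (\<lambda>w x. card (G j w \<inter> G 1 x))"
proof -
  obtain b c where b: "\<And>i v w. v \<in> V \<Longrightarrow> w \<in> V \<Longrightarrow> d v w = i \<Longrightarrow> card (G (Suc i) v \<inter> G 1 w) = b i"
    and c: "\<And>i v w. v \<in> V \<Longrightarrow> w \<in> V \<Longrightarrow> d v w = Suc i \<Longrightarrow> card (G i v \<inter> G 1 w) = c (Suc i)"
    and "\<And>i. Suc i \<in> I \<Longrightarrow> b i > 0"
    by (rule intersection_array) (rule that)
  have far: "G j w \<inter> G 1 x = {}" if "w \<in> V" "x \<in> V" "d w x = h" "j \<noteq> h" "j \<noteq> Suc h" "h \<noteq> Suc j"
    for w x h
    using that dist_neighbour[of w x] by (fastforce simp: in_sphere)
  have deg: "card (G 1 x) = b 0" if "x \<in> V" for x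
    using b[of x x 0] that by simp
  \<comment> \<open>For \<open>h = 0\<close> the truncated difference \<open>h - 1\<close> is again
    \<open>0\<close>; the inner layer is left out so that layer \<open>h\<close> is not counted
    twice.\<close>
  have split: "card (G 1 x) = card (G h w \<inter> G 1 x) + card (G (Suc h) w \<inter> G 1 x)
      + (if h = 0 then 0 else card (G (h - 1) w \<inter> G 1 x))"
    if "w \<in> V" "x \<in> V" "d w x = h" for w x h
  proof -
    have "G 1 x = (G h w \<inter> G 1 x) \<union> (G (Suc h) w \<inter> G 1 x)
        \<union> (if h = 0 then {} else G (h - 1) w \<inter> G 1 x)"
      using that dist_neighbour[of w x] by (force simp: in_sphere)
    then have "card (G 1 x) = card ((G h w \<inter> G 1 x) \<union> (G (Suc h) w \<inter> G 1 x)
        \<union> (if h = 0 then {} else G (h - 1) w \<inter> G 1 x))" by simp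
    also have "\<dots> = card ((G h w \<inter> G 1 x) \<union> (G (Suc h) w \<inter> G 1 x))
        + card (if h = 0 then {} else G (h - 1) w \<inter> G 1 x)"
      using finite_sphere that by (intro card_Un_disjoint) (auto simp: in_sphere)
    also have "card ((G h w \<inter> G 1 x) \<union> (G (Suc h) w \<inter> G 1 x))
        = card (G h w \<inter> G 1 x) + card (G (Suc h) w \<inter> G 1 x)"
      using finite_sphere that by (intro card_Un_disjoint) (auto simp: in_sphere)
    finally show ?thesis by simp
  qed
  have "card (G j w \<inter> G 1 x) = card (G j w' \<inter> G 1 x')"
    if "w \<in> V" "x \<in> V" "w' \<in> V" "x' \<in> V" "d w x = d w' x'" for w x w' x'
  proof -
    define h where "h = d w x"
    have h: "d w x = h" "d w' x' = h" using that by (auto simp: h_def)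
    consider "j = Suc h" | "h = Suc j" | "j = h" | "j \<noteq> h" "j \<noteq> Suc h" "h \<noteq> Suc j" by blast
    then show ?thesis
    proof cases
      case 1
      then show ?thesis using b h that by simp
    next
      case 2
      then show ?thesis using c h that by simp
    next
      case 3
      show ?thesis
      proof (cases h)
        case 0
        then show ?thesis
          using 3 split[of w x h] split[of w' x' h] deg b[of w x h] b[of w' x' h] h that by simp
      next
        case (Suc h')
        then show ?thesis
          using 3 split[of w x h] split[of w' x' h] deg b[of w x h] b[of w' x' h]
            c[of w x h'] c[of w' x' h'] h that by simp
      qed
    next
      case 4
      then show ?thesis using far h that by simp
    qed
  qed
  then show ?thesis unfolding dist_invariant_def by blast
qed

text \<open>The diameter is a supremum over all pairs and says little about a given
  \<open>v\<close>; positivity of \<open>b\<close> leads outward from \<open>v\<close>, one sphere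
  at a time.\<close>

lemma sphere_nonempty: "i \<in> I \<Longrightarrow> v \<in> V \<Longrightarrow> G i v \<noteq> {}"
proof (induction i)
  case (Suc i)
  have "i \<in> I" using Suc(2) by (auto simp: dist_indices_def Suc_ile_eq)
  then obtain w where w: "w \<in> V" "d v w = i" using Suc by (fastforce simp: in_sphere)
  obtain b c where b: "\<And>i v w. v \<in> V \<Longrightarrow> w \<in> V \<Longrightarrow> d v w = i \<Longrightarrow> card (G (Suc i) v \<inter> G 1 w) = b i"
    and "\<And>i v w. v \<in> V \<Longrightarrow> w \<in> V \<Longrightarrow> d v w = Suc i \<Longrightarrow> card (G i v \<inter> G 1 w) = c (Suc i)"
    and pos: "\<And>i. Suc i \<in> I \<Longrightarrow> b i > 0"
    by (rule intersection_array) (rule that)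
  have "card (G (Suc i) v \<inter> G 1 w) \<noteq> 0"
    using b[OF Suc.prems(2) w] pos[OF Suc.prems(1)] by simp
  then show ?case by auto
qed (simp add: sphere_0)

text \<open>In the identity \<open>count\<close> only the top term on the left involves a sphere of
  radius larger than \<open>j'\<close> around \<open>w\<close>. Its coefficient is positive, so the
  remaining terms determine it. The right side changes the radius \<open>i\<close>, hence the
  induction covers all \<open>i\<close> at once.\<close>

lemma dist_invariant_sphere_Int:
  "dist_invariant (\<lambda>v w. card (G i v \<inter> G j w))"
proof (induction j arbitrary: i rule: less_induct)
  case (less j)
  show ?case
  proof (cases j)
    case 0
    have "card (G i v \<inter> G 0 w) = (if i = d v w then 1 else 0)" if "v \<in> V" "w \<in> V" for v w
      using that by (auto simp: sphere_0 in_sphere)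
    then show ?thesis by (auto simp: dist_invariant_def 0)
  next
    case (Suc j')
    \<comment> \<open>\<open>f j h\<close> is the number of neighbours in \<open>G j w\<close> of a
      point at distance \<open>h\<close> from \<open>w\<close>; thus \<open>f j' (Suc j')\<close> is
      the constant \<open>c\<close> of index \<open>Suc j'\<close>.\<close>
    obtain f where f: "\<And>j w x. w \<in> V \<Longrightarrow> x \<in> V \<Longrightarrow> card (G j w \<inter> G 1 x) = f j (d w x)"
    proof -
      have "\<exists>f. \<forall>w\<in>V. \<forall>x\<in>V. card (G j w \<inter> G 1 x) = f (d w x)" for j
        using dist_invariant_fun[OF dist_invariant_neighbours[of j]] by metis
      then show thesis using that by metis
    qed
    \<comment> \<open>A shortest walk from \<open>v\<close> to \<open>w\<close> enters
      \<open>w\<close> from \<open>G j' v\<close>, so at least one neighbour is counted.\<close>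
    have f_pos: "f j' (Suc j') > 0" if I: "Suc j' \<in> I" and "v \<in> V" for v
    proof -
      obtain w where w: "w \<in> V" "d v w = Suc j'"
        using sphere_nonempty[OF I \<open>v \<in> V\<close>] by (auto simp: in_sphere)
      obtain u where u: "u \<in> V" "d v u = j'" "(u, w) \<in> E"
        using dist_Suc_split[OF \<open>v \<in> V\<close> w] .
      then have "u \<in> G j' v \<inter> G 1 w"
        using edge_dist[OF u(3)] by (auto simp: in_sphere dist_sym)
      then have "card (G j' v \<inter> G 1 w) > 0"
        using finite_sphere[OF \<open>v \<in> V\<close>] by (auto simp: card_gt_0_iff)
      then show ?thesis
        using f[OF \<open>v \<in> V\<close> w(1), of j'] w(2) by simp
    qed
    have f_zero: "f j' h = 0" if "w \<in> V" "x \<in> V" "d w x = h" "h > Suc j'" for w x h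
    proof -
      have "u \<notin> G j' w \<inter> G 1 x" for u
        using that dist_neighbour[of w x u] by (auto simp: in_sphere)
      then have "G j' w \<inter> G 1 x = {}" by blast
      then show ?thesis using f[of w x j'] that by simp
    qed
    have count: "(\<Sum>h\<le>Suc j'. f j' h * card (G i v \<inter> G h w))
        = (\<Sum>h\<le>Suc i. f i h * card (G h v \<inter> G j' w))"
      if vw: "v \<in> V" "w \<in> V" for v w
    proof -
      \<comment> \<open>The ranges are enlarged to contain every distance that occurs, as grouping
        by distance requires; the coefficients vanish at the added indices.\<close>
      let ?S = "{..Suc j'} \<union> d w ` G i v"
      let ?T = "{..Suc i} \<union> d v ` G j' w"
      have "(\<Sum>h\<le>Suc j'. f j' h * card (G i v \<inter> G h w)) = (\<Sum>h\<in>?S. f j' h * card (G i v \<inter> G h w))"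
        using f_zero vw finite_sphere by (intro sum.mono_neutral_left) (auto simp: in_sphere not_le)
      also have "\<dots> = (\<Sum>x\<in>G i v. f j' (d w x))"
        using sum_sphere_by_dist[of v ?S w i "f j'"] vw finite_sphere by simp
      also have "\<dots> = (\<Sum>x\<in>G i v. card (G j' w \<inter> G 1 x))"
        using f vw by (intro sum.cong) (auto simp: in_sphere)
      also have "\<dots> = (\<Sum>u\<in>G j' w. card (G i v \<inter> G 1 u))"
        by (rule sphere_double_count[OF vw])
      also have "\<dots> = (\<Sum>u\<in>G j' w. f i (d v u))"
        using f vw by (intro sum.cong) (auto simp: in_sphere)
      also have "\<dots> = (\<Sum>h\<in>?T. f i h * card (G j' w \<inter> G h v))"
        using sum_sphere_by_dist[of w ?T v j' "f i"] vw finite_sphere by simp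
      also have "\<dots> = (\<Sum>h\<le>Suc i. f i h * card (G h v \<inter> G j' w))"
      proof (intro sum.mono_neutral_cong_right)
        have "f i (d v u) = 0" if "u \<in> V" "d v u > Suc i" for u
        proof -
          have "x \<notin> G i v \<inter> G 1 u" for x
            using that vw dist_neighbour[of v u x] by (auto simp: in_sphere)
          then have "G i v \<inter> G 1 u = {}" by blast
          then show ?thesis using f[of v u i] that vw by simp
        qed
        then show "\<forall>h\<in>?T - {..Suc i}. f i h * card (G j' w \<inter> G h v) = 0"
          by (auto simp: in_sphere not_le)
      qed (use finite_sphere vw in \<open>auto simp: Int_commute\<close>)
      finally show ?thesis .
    qed
    have "card (G i v \<inter> G (Suc j') w) = card (G i v' \<inter> G (Suc j') w')"
      if vw: "v \<in> V" "w \<in> V" "v' \<in> V" "w' \<in> V" "d v w = d v' w'" for v w v' w'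
    proof (cases "Suc j' \<in> I")
      case True
      have eq: "card (G h v \<inter> G l w) = card (G h v' \<inter> G l w')" if "l \<le> j'" for h l
        using dist_invariantD[OF less.IH[of l h] vw] that Suc by simp
      have "(\<Sum>h\<le>Suc j'. f j' h * card (G i v \<inter> G h w))
        = (\<Sum>h\<le>Suc j'. f j' h * card (G i v' \<inter> G h w'))"
        unfolding count[OF vw(1,2)] count[OF vw(3,4)] by (simp add: eq)
      moreover have "(\<Sum>h\<le>j'. f j' h * card (G i v \<inter> G h w))
        = (\<Sum>h\<le>j'. f j' h * card (G i v' \<inter> G h w'))"
        using eq by simp
      \<comment> \<open>Removing the equal lower terms leaves the top terms, where the positive
        factor \<open>f j' (Suc j')\<close> cancels.\<close>
      ultimately show ?thesis using f_pos[OF True vw(1)] by simp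
    qed (use sphere_disjoint_I vw in auto)
    then show ?thesis unfolding dist_invariant_def Suc by blast
  qed
qed

end

section \<open>Intersection numbers and transition probabilities\<close>

context distance_regular_graph
begin

lemma ex_at_dist:
  assumes "v \<in> V" "k \<in> I"
  obtains w where "w \<in> V" "d v w = k"
  using sphere_nonempty[OF assms(2,1)] unfolding sphere_at_def by blast

abbreviation "p \<equiv> intersection_number V E"

text \<open>Distance invariance shows that this count satisfies the definite description; uniqueness
  holds because \<open>(v, w)\<close> lies in the relation of index \<open>k\<close>.\<close>

lemma intersection_number_eq:
  assumes "v \<in> V" "w \<in> V" "d v w = k"
  shows "p i j k = card (G i v \<inter> G j w)"
proof -
  have set: "{u \<in> V. d v u = i \<and> d u w = j} = G i v \<inter> G j w" for v w
    by (auto simp: in_sphere dist_sym)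
  show ?thesis
    unfolding intersection_number_def set
  proof (rule the_equality)
    show "\<forall>(v', w') \<in> dist_rel V E k. finite (G i v' \<inter> G j w') \<and>
        card (G i v' \<inter> G j w') = card (G i v \<inter> G j w)"
    proof (clarify, intro conjI)
      fix v' w' assume "(v', w') \<in> dist_rel V E k"
      then have v'w': "v' \<in> V" "w' \<in> V" "d v' w' = k" by (simp_all add: dist_rel_def)
      show "finite (G i v' \<inter> G j w')" using finite_sphere[OF v'w'(1)] by simp
      show "card (G i v' \<inter> G j w') = card (G i v \<inter> G j w)"
        by (rule dist_invariantD[OF dist_invariant_sphere_Int]) (use assms v'w' in simp_all)
    qed
    fix n assume "\<forall>(v, w) \<in> dist_rel V E k. finite (G i v \<inter> G j w) \<and> card (G i v \<inter> G j w) = n"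
    moreover have "(v, w) \<in> dist_rel V E k" using assms by (simp add: dist_rel_def)
    ultimately show "n = card (G i v \<inter> G j w)" by (auto dest!: bspec)
  qed
qed

lemma card_sphere: "v \<in> V \<Longrightarrow> card (G i v) = p i i 0"
  using intersection_number_eq[of v v 0 i i] by simp

lemma valency_pos: "i \<in> I \<Longrightarrow> v \<in> V \<Longrightarrow> p i i 0 > 0"
  using sphere_nonempty[of i v] finite_sphere[of v i] card_sphere[of v i] by (metis card_gt_0_iff)

text \<open>Reading a pair at distance \<open>k\<close> backwards exchanges the two spheres.\<close>

lemma intersection_number_commute:
  assumes "v \<in> V" "k \<in> I"
  shows "p i j k = p j i k"
proof -
  obtain w where "w \<in> V" "d v w = k"
    using ex_at_dist[OF assms] .
  then show ?thesis
    using intersection_number_eq[of v w k i j] intersection_number_eq[of w v k j i] assms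
    by (simp add: dist_sym Int_commute)
qed

text \<open>Pairs of a point in \<open>G i v\<^sub>0\<close> and a point in
  \<open>G k v\<^sub>0\<close> at distance \<open>j\<close> are counted from both ends. Outside
  \<open>I\<close> both sides are zero: division by a zero valency gives zero, and for
  \<open>k\<close> outside \<open>I\<close> the unspecified \<open>p i j k\<close> is multiplied by
  zero.\<close>

lemma walk_coeff_eq:
  assumes "v\<^sub>0 \<in> V"
  shows "walk_coeff V E v\<^sub>0 i j k = p k k 0 * p i j k / (p i i 0 * p j j 0)"
proof -
  have "(\<Sum>v\<in>G i v\<^sub>0. card (G k v\<^sub>0 \<inter> G j v)) = (\<Sum>u\<in>G k v\<^sub>0. card (G i v\<^sub>0 \<inter> G j u))"
    by (rule sphere_double_count[OF assms assms])
  also have "\<dots> = (\<Sum>u\<in>G k v\<^sub>0. p i j k)"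
    using assms intersection_number_eq by (intro sum.cong) (auto simp: in_sphere)
  finally have count: "(\<Sum>v\<in>G i v\<^sub>0. card (G j v \<inter> G k v\<^sub>0)) = p k k 0 * p i j k"
    using assms by (simp add: card_sphere Int_commute)
  have "(\<Sum>v\<in>G i v\<^sub>0. real (card (G j v \<inter> G k v\<^sub>0)) / real (card (G j v))) =
      (\<Sum>v\<in>G i v\<^sub>0. real (card (G j v \<inter> G k v\<^sub>0))) / real (p j j 0)"
    unfolding sum_divide_distrib by (intro sum.cong) (auto simp: card_sphere in_sphere)
  also have "\<dots> = real (p k k 0 * p i j k) / real (p j j 0)"
    unfolding count[symmetric] by simp
  finally show ?thesis
    using assms by (simp add: walk_coeff_def card_sphere)
qed

text \<open>By the triangle inequality the walk stays within distance \<open>i + j\<close> of its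
  base point, so every basis product is a finite sum.\<close>

lemma walk_coeff_eq_0:
  assumes "v\<^sub>0 \<in> V" "k > i + j"
  shows "walk_coeff V E v\<^sub>0 i j k = 0"
proof -
  have "G j v \<inter> G k v\<^sub>0 = {}" if "v \<in> G i v\<^sub>0" for v
    using that assms dist_triangle[OF assms(1), of v] by (force simp: in_sphere)
  then show ?thesis by (simp add: walk_coeff_def)
qed

lemma finite_walk_coeff: "v\<^sub>0 \<in> V \<Longrightarrow> finite {k \<in> I. walk_coeff V E v\<^sub>0 i j k \<noteq> 0}"
  by (rule finite_subset[of _ "{..i + j}"]) (use walk_coeff_eq_0 not_less in blast)+

text \<open>For each \<open>v\<close> in \<open>G i v\<^sub>0\<close>, the spheres of radius at most
  \<open>i + j\<close> around \<open>v\<^sub>0\<close> partition \<open>G j v\<close>, so the inner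
  fractions add up to one.\<close>

lemma sum_walk_coeff:
  assumes "v\<^sub>0 \<in> V" "i \<in> I" "j \<in> I"
  shows "(\<Sum>k | k \<in> I \<and> walk_coeff V E v\<^sub>0 i j k \<noteq> 0. walk_coeff V E v\<^sub>0 i j k) = 1"
proof -
  have "walk_coeff V E v\<^sub>0 i j k = 0" if "k \<notin> I" for k
    using that assms sphere_disjoint_I by (simp add: walk_coeff_def)
  then have "(\<Sum>k | k \<in> I \<and> walk_coeff V E v\<^sub>0 i j k \<noteq> 0. walk_coeff V E v\<^sub>0 i j k) =
      (\<Sum>k\<le>i + j. walk_coeff V E v\<^sub>0 i j k)"
    using walk_coeff_eq_0[OF assms(1)] by (intro sum.mono_neutral_left) (auto intro: leI)
  also have "\<dots> = 1 / real (p i i 0) * (\<Sum>k\<le>i + j.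
      \<Sum>v\<in>G i v\<^sub>0. real (card (G j v \<inter> G k v\<^sub>0)) / real (card (G j v)))"
    by (simp add: walk_coeff_def sum_distrib_left card_sphere assms)
  also have "\<dots> = 1 / real (p i i 0) *
      (\<Sum>v\<in>G i v\<^sub>0. (\<Sum>k\<le>i + j. real (card (G j v \<inter> G k v\<^sub>0))) / real (card (G j v)))"
    by (subst sum.swap) (simp add: sum_divide_distrib)
  also have "(\<Sum>v\<in>G i v\<^sub>0. (\<Sum>k\<le>i + j. real (card (G j v \<inter> G k v\<^sub>0))) / real (card (G j v))) =
      (\<Sum>v\<in>G i v\<^sub>0. 1)"
  proof (intro sum.cong refl)
    fix v assume v: "v \<in> G i v\<^sub>0"
    then have "d v\<^sub>0 ` G j v \<subseteq> {..i + j}"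
      using dist_triangle[OF assms(1), of v] by (fastforce simp: in_sphere)
    then have "(\<Sum>k\<le>i + j. real (card (G j v \<inter> G k v\<^sub>0))) = real (card (G j v))"
      using sum_sphere_by_dist[of v "{..i + j}" v\<^sub>0 j "\<lambda>_. 1 :: real"] v by (simp add: in_sphere)
    moreover have "card (G j v) > 0"
      using v assms by (simp add: in_sphere card_sphere valency_pos)
    ultimately show "(\<Sum>k\<le>i + j. real (card (G j v \<inter> G k v\<^sub>0))) / real (card (G j v)) = 1"
      by simp
  qed
  also have "1 / real (p i i 0) * (\<Sum>v\<in>G i v\<^sub>0. 1) = 1"
    using assms valency_pos by (simp add: card_sphere)
  finally show ?thesis .
qed

text \<open>Both sides count the paths \<open>v, u, u', w\<close> with steps at distances \<open>i\<close>, \<open>j\<close>, \<open>k\<close>, where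
  \<open>d v w = m\<close>.\<close>

lemma sum_intersection_numbers_assoc:
  assumes "v \<in> V" "w \<in> V" "d v w = m"
    and "finite S" "d v ` G k w \<subseteq> S" and "finite T" "d w ` G i v \<subseteq> T"
  shows "(\<Sum>l\<in>S. p i j l * p l k m) = (\<Sum>l\<in>T. p j k l * p i l m)"
proof -
  have "(\<Sum>l\<in>S. p i j l * p l k m) = (\<Sum>l\<in>S. p i j l * card (G k w \<inter> G l v))"
    using assms by (simp add: intersection_number_eq Int_commute)
  also have "\<dots> = (\<Sum>u\<in>G k w. p i j (d v u))"
    using sum_sphere_by_dist[of w S v k "p i j"] assms by simp
  also have "\<dots> = (\<Sum>u\<in>G k w. card (G i v \<inter> G j u))"
    using assms by (intro sum.cong) (auto simp: in_sphere intersection_number_eq)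
  also have "\<dots> = (\<Sum>u\<in>G i v. card (G k w \<inter> G j u))"
    by (rule sphere_double_count[symmetric]) (use assms in auto)
  also have "\<dots> = (\<Sum>u\<in>G i v. p j k (d w u))"
    using assms
    by (intro sum.cong)
      (auto simp: in_sphere intersection_number_eq[OF _ _ dist_sym] Int_commute)
  also have "\<dots> = (\<Sum>l\<in>T. p j k l * card (G i v \<inter> G l w))"
    using sum_sphere_by_dist[of v T w i "p j k"] assms by simp
  also have "\<dots> = (\<Sum>l\<in>T. p j k l * p i l m)"
    using assms by (simp add: intersection_number_eq)
  finally show ?thesis .
qed

lemma hermitian_coeffs_walk_coeff:
  assumes "v\<^sub>0 \<in> V"
  shows "hermitian_coeffs I (walk_coeff V E v\<^sub>0) 0"
proof
  let ?P = "walk_coeff V E v\<^sub>0"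
  note P = walk_coeff_eq[OF assms]
  show "0 \<in> I" using dist_in_I[OF assms assms] by simp
  fix i j assume ij: "i \<in> I" "j \<in> I"
  show "finite {k \<in> I. ?P i j k \<noteq> 0}" by (rule finite_walk_coeff[OF assms])
  show "(\<Sum>k | k \<in> I \<and> ?P i j k \<noteq> 0. ?P i j k) = 1" by (rule sum_walk_coeff[OF assms ij])
  \<comment> \<open>Spheres of different radii around one point are disjoint; this yields the
    support condition at the unit.\<close>
  have p0: "p i j 0 = (if i = j then p i i 0 else 0)"
  proof (cases "i = j")
    case False
    then have "G i v\<^sub>0 \<inter> G j v\<^sub>0 = {}" by (auto simp: in_sphere)
    then show ?thesis using False intersection_number_eq[of v\<^sub>0 v\<^sub>0 0 i j] assms by simp
  qed simp
  have p00: "p 0 0 0 = 1"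
    using card_sphere[OF assms, of 0] assms by (simp add: sphere_0)
  show "?P i j 0 \<noteq> 0 \<longleftrightarrow> i = j"
    using ij valency_pos[OF _ assms] by (auto simp: P p0 p00)
  fix k assume k: "k \<in> I"
  show "?P i j k \<ge> 0" by (simp add: P)
  show "?P i j k = ?P j i k"
    using intersection_number_commute[OF assms k] by (simp add: P mult.commute)
  fix m assume m: "m \<in> I"
  obtain w where w: "w \<in> V" "d v\<^sub>0 w = m"
    using ex_at_dist[OF assms m] .
  \<comment> \<open>The supports are enlarged by the distances that occur in the path count, to meet
    the range conditions of \<open>sum_intersection_numbers_assoc\<close>.\<close>
  let ?S = "{l \<in> I. ?P i j l \<noteq> 0} \<union> d v\<^sub>0 ` G k w"
  let ?T = "{l \<in> I. ?P j k l \<noteq> 0} \<union> d w ` G i v\<^sub>0"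
  have fin: "finite ?S" "finite ?T"
    using finite_walk_coeff finite_sphere assms w by auto
  have sub: "?S \<subseteq> I" "?T \<subseteq> I"
    using dist_in_I assms w by (auto simp: in_sphere)
  \<comment> \<open>The valency of the intermediate index \<open>l\<close> cancels, which leaves the
    same factor for both bracketings.\<close>
  let ?c = "p m m 0 / (p i i 0 * p j j 0 * p k k 0)"
  have PP: "?P i j l * ?P l k m = ?c * (p i j l * p l k m)"
    "?P j k l * ?P i l m = ?c * (p j k l * p i l m)" if "l \<in> I" for l
    using valency_pos[OF that assms] by (simp_all add: P mult_ac)
  have "(\<Sum>l | l \<in> I \<and> ?P i j l \<noteq> 0. ?P i j l * ?P l k m) = (\<Sum>l\<in>?S. ?P i j l * ?P l k m)"
    using fin sub by (intro sum.mono_neutral_left) auto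
  also have "\<dots> = (\<Sum>l\<in>?S. ?c * (p i j l * p l k m))"
    by (intro sum.cong refl PP(1) subsetD[OF sub(1)])
  also have "\<dots> = ?c * real (\<Sum>l\<in>?S. p i j l * p l k m)"
    by (simp add: sum_distrib_left)
  also have "(\<Sum>l\<in>?S. p i j l * p l k m) = (\<Sum>l\<in>?T. p j k l * p i l m)"
    using fin sub by (intro sum_intersection_numbers_assoc[OF assms w]) auto
  also have "?c * real \<dots> = (\<Sum>l\<in>?T. ?c * (p j k l * p i l m))"
    by (simp add: sum_distrib_left)
  also have "\<dots> = (\<Sum>l\<in>?T. ?P j k l * ?P i l m)"
    by (intro sum.cong refl PP(2)[symmetric] subsetD[OF sub(2)])
  also have "\<dots> = (\<Sum>l | l \<in> I \<and> ?P j k l \<noteq> 0. ?P j k l * ?P i l m)"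
    using fin sub by (intro sum.mono_neutral_right) auto
  finally show "(\<Sum>l | l \<in> I \<and> ?P i j l \<noteq> 0. ?P i j l * ?P l k m) =
      (\<Sum>l | l \<in> I \<and> ?P j k l \<noteq> 0. ?P j k l * ?P i l m)" .
next
  let ?P = "walk_coeff V E v\<^sub>0"
  fix j k assume jk: "j \<in> I" "k \<in> I"
  obtain w where w: "w \<in> V" "d v\<^sub>0 w = k"
    using ex_at_dist[OF assms jk(2)] .
  then have "p 0 j k = (if j = k then 1 else 0)"
    using assms by (auto simp: intersection_number_eq sphere_0 in_sphere dist_sym)
  moreover have "p 0 0 0 = 1"
    using card_sphere[OF assms, of 0] assms by (simp add: sphere_0)
  ultimately show "?P 0 j k = (if j = k then 1 else 0)"
    using valency_pos[OF jk(2) assms] by (simp add: walk_coeff_eq[OF assms])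
qed

end

lemma sum_apply2: "(\<Sum>k\<in>S. F k) v w = (\<Sum>k\<in>S. F k v w)"
  for F :: "'i \<Rightarrow> 'a \<Rightarrow> 'b \<Rightarrow> 'c::comm_monoid_add"
  by (induction S rule: infinite_finite_induct) simp_all

section \<open>The algebra of distance matrices\<close>

interpretation mat: vector_space mat_scale
  by unfold_locales (auto simp: mat_scale_def algebra_simps fun_eq_iff)

text \<open>Finite rows turn the \<open>infsum\<close> in \<open>mat_prod\<close> into a finite sum.
  For general matrices additivity can fail, since \<open>infsum\<close> is zero on a family that is
  not summable.\<close>

definition row_finite :: "'a set \<Rightarrow> 'a vmat \<Rightarrow> bool" where
  "row_finite V M \<longleftrightarrow> (\<forall>v. finite {u \<in> V. M v u \<noteq> 0})"

text \<open>The zeros in row \<open>v\<close> of the left factor cut the sum down to a finite one,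
  whatever the right factor is.\<close>

lemma summable_row:
  assumes "row_finite V M"
  shows "(\<lambda>u. M v u * N u w) summable_on V"
proof -
  have "(\<lambda>u. M v u * N u w) summable_on V \<longleftrightarrow> (\<lambda>u. M v u * N u w) summable_on {u \<in> V. M v u \<noteq> 0}"
    by (rule summable_on_cong_neutral) auto
  then show ?thesis using assms by (simp add: row_finite_def summable_on_finite)
qed

lemma mat_prod_add_left:
  assumes "row_finite V M" "row_finite V M'"
  shows "mat_prod V (M + M') N = mat_prod V M N + mat_prod V M' N"
  by (intro ext)
    (simp add: mat_prod_def distrib_right
      infsum_add[OF summable_row[OF assms(1)] summable_row[OF assms(2)]])

lemma mat_prod_add_right:
  assumes "row_finite V M"
  shows "mat_prod V M (N + N') = mat_prod V M N + mat_prod V M N'"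
  by (intro ext)
    (simp add: mat_prod_def distrib_left
      infsum_add[OF summable_row[OF assms] summable_row[OF assms]])

lemma mat_prod_scale_left: "mat_prod V (mat_scale a M) N = mat_scale a (mat_prod V M N)"
  by (simp add: mat_prod_def mat_scale_def fun_eq_iff mult.assoc infsum_cmult_right')

lemma mat_prod_scale_right: "mat_prod V M (mat_scale a N) = mat_scale a (mat_prod V M N)"
  by (simp add: mat_prod_def mat_scale_def fun_eq_iff mult.left_commute[of _ a] infsum_cmult_right')

lemma row_finite_span:
  assumes "\<And>M. M \<in> S \<Longrightarrow> row_finite V M" and "M \<in> mat.span S"
  shows "row_finite V M"
  using assms(2)
proof (induction M rule: mat.span_induct_closed)
  case (add M N)
  have "finite {u \<in> V. (M + N) v u \<noteq> 0}" for v
    by (rule finite_subset[of _ "{u \<in> V. M v u \<noteq> 0} \<union> {u \<in> V. N v u \<noteq> 0}"])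
      (use add in \<open>auto simp: row_finite_def\<close>)
  then show ?case by (simp add: row_finite_def)
next
  case (scale a M)
  have "finite {u \<in> V. mat_scale a M v u \<noteq> 0}" for v
    by (rule finite_subset[of _ "{u \<in> V. M v u \<noteq> 0}"])
      (use scale in \<open>auto simp: row_finite_def mat_scale_def\<close>)
  then show ?case by (simp add: row_finite_def)
qed (use assms(1) in \<open>auto simp: row_finite_def\<close>)

lemma lookup_free_scale [simp]: "Poly_Mapping.lookup (free_scale a \<mu>) x = a * Poly_Mapping.lookup \<mu> x"
  by (simp add: free_scale_def Poly_Mapping.map.rep_eq when_def)

interpretation free: vector_space free_scale
  by unfold_locales (auto intro!: poly_mapping_eqI simp: lookup_add algebra_simps)

section \<open>Normalized distance matrices and their products\<close>

context distance_regular_graph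
begin

abbreviation "C \<equiv> normalized_dist_matrix V E"
abbreviation "R \<equiv> basis_rel V E"

lemma C_apply:
  "C i v w = (if v \<in> V \<and> w \<in> V \<and> d v w = i then inverse (of_nat (p i i 0)) else 0)"
  by (simp add: normalized_dist_matrix_def mat_scale_def dist_matrix_def)

lemma row_finite_C: "row_finite V (C i)"
  unfolding row_finite_def
proof
  fix v
  show "finite {u \<in> V. C i v u \<noteq> 0}"
  proof (cases "v \<in> V")
    case True
    show ?thesis
      by (rule finite_subset[OF _ finite_sphere[OF True, of i]]) (auto simp: C_apply in_sphere)
  qed (simp add: C_apply)
qed

text \<open>Only \<open>u\<close> in \<open>G i v \<inter> G j w\<close> contributes, and each such
  \<open>u\<close> contributes the same product of inverse valencies.\<close>

lemma mat_prod_C_apply: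
  "mat_prod V (C i) (C j) v w =
    (if v \<in> V \<and> w \<in> V then of_nat (p i j (d v w)) / (of_nat (p i i 0) * of_nat (p j j 0)) else 0)"
proof (cases "v \<in> V \<and> w \<in> V")
  case True
  have "mat_prod V (C i) (C j) v w = (\<Sum>\<^sub>\<infinity>u\<in>G i v \<inter> G j w. C i v u * C j u w)"
    unfolding mat_prod_def
    by (rule infsum_cong_neutral) (auto simp: C_apply in_sphere dist_sym)
  also have "\<dots> = (\<Sum>u\<in>G i v \<inter> G j w. C i v u * C j u w)"
    using True by (intro infsum_finite) (simp add: finite_sphere)
  also have "\<dots> = (\<Sum>u\<in>G i v \<inter> G j w. inverse (of_nat (p i i 0)) * inverse (of_nat (p j j 0)))"
    using True by (intro sum.cong) (auto simp: C_apply in_sphere dist_sym)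
  finally show ?thesis
    using True by (simp add: intersection_number_eq[OF _ _ refl] divide_inverse)
next
  case False
  then have "mat_prod V (C i) (C j) v w = (\<Sum>\<^sub>\<infinity>u\<in>V. 0)"
    unfolding mat_prod_def by (intro infsum_cong) (auto simp: C_apply)
  then show ?thesis using False by auto
qed

text \<open>At entry \<open>(v, w)\<close> only the matrix of index \<open>k = d v w\<close> is
  nonzero, and there the factor \<open>p k k 0\<close> of the walk coefficient cancels against the
  normalization of \<open>C k\<close>.\<close>

lemma mat_prod_C:
  assumes "v\<^sub>0 \<in> V" "i \<in> I" "j \<in> I"
  shows "mat_prod V (C i) (C j) =
    (\<Sum>k | k \<in> I \<and> walk_coeff V E v\<^sub>0 i j k \<noteq> 0.
      mat_scale (of_real (walk_coeff V E v\<^sub>0 i j k)) (C k))"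
proof (intro ext)
  fix v w
  let ?P = "walk_coeff V E v\<^sub>0 i j"
  let ?K = "{k \<in> I. ?P k \<noteq> 0}"
  have "(\<Sum>k\<in>?K. mat_scale (of_real (?P k)) (C k)) v w = (\<Sum>k\<in>?K. of_real (?P k) * C k v w)"
    by (simp add: sum_apply2 mat_scale_def)
  also have "\<dots> = mat_prod V (C i) (C j) v w"
  proof (cases "v \<in> V \<and> w \<in> V")
    case True
    then have dI: "d v w \<in> I" by (simp add: dist_in_I)
    have "(\<Sum>k\<in>?K. of_real (?P k) * C k v w) =
        (\<Sum>k\<in>?K. if k = d v w then of_real (?P k) * inverse (of_nat (p k k 0)) else 0)"
      using True by (intro sum.cong) (auto simp: C_apply)
    also have "\<dots> = of_real (?P (d v w)) * inverse (of_nat (p (d v w) (d v w) 0))"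
      using dI finite_walk_coeff[OF assms(1)] by (auto simp: sum.delta)
    also have "\<dots> = mat_prod V (C i) (C j) v w"
      using valency_pos[OF dI assms(1)] True
      by (simp add: walk_coeff_eq[OF assms(1)] mat_prod_C_apply)
    finally show ?thesis .
  next
    case False
    then have "C k v w = 0" for k by (auto simp: C_apply)
    then show ?thesis using False by (auto simp: mat_prod_C_apply)
  qed
  finally show "mat_prod V (C i) (C j) v w =
      (\<Sum>k\<in>?K. mat_scale (of_real (?P k)) (C k)) v w" ..
qed

lemma hermitian_basis_C:
  assumes "v\<^sub>0 \<in> V"
  shows "hermitian_basis mat_scale I (walk_coeff V E v\<^sub>0) 0 C (mat_prod V)"
proof -
  interpret hermitian_coeffs I "walk_coeff V E v\<^sub>0" 0
    by (rule hermitian_coeffs_walk_coeff[OF assms])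
  have "\<exists>w. k \<in> I \<longrightarrow> w \<in> V \<and> d v\<^sub>0 w = k" for k
    using ex_at_dist[OF assms] by metis
  then obtain w where w: "\<And>k. k \<in> I \<Longrightarrow> w k \<in> V \<and> d v\<^sub>0 (w k) = k" by metis
  \<comment> \<open>One entry at distance \<open>k\<close> from the base point, rescaled by the
    valency, gives a coordinate dual to \<open>C k\<close>.\<close>
  define f :: "nat \<Rightarrow> 'a vmat \<Rightarrow> complex" where "f k M = of_nat (p k k 0) * M v\<^sub>0 (w k)" for k M
  have f: "inj_on C I" "mat.independent (C ` I)"
    by (rule mat.independent_familyI[of I f];
        simp add: f_def mat_scale_def C_apply w assms valency_pos[OF _ assms] algebra_simps)+
  have rf: "row_finite V M" if "M \<in> mat.span (C ` I)" for M
    using row_finite_span[OF _ that] row_finite_C by auto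
  show ?thesis
    by unfold_locales
      (use f mat_prod_C[OF assms] in \<open>auto simp: mat_prod_add_left mat_prod_add_right rf
        mat_prod_scale_left mat_prod_scale_right\<close>)
qed

section \<open>The convolution on the relations\<close>

text \<open>Relations with index in \<open>I\<close> are nonempty, and a pair has only one distance.
  This keeps the free generators distinct.\<close>

lemma inj_dist_rel:
  assumes "v\<^sub>0 \<in> V"
  shows "inj_on (dist_rel V E) I"
proof (rule inj_onI)
  fix i j assume "i \<in> I" "dist_rel V E i = dist_rel V E j"
  moreover from \<open>i \<in> I\<close> obtain w where "w \<in> V" "d v\<^sub>0 w = i"
    using ex_at_dist[OF assms] by blast
  ultimately show "i = j" using assms by (auto simp: dist_rel_def)
qed

lemma finite_rel_support:
  assumes "v\<^sub>0 \<in> V"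
  shows "finite {i \<in> I. Poly_Mapping.lookup \<mu> (dist_rel V E i) \<noteq> 0}"
proof (rule finite_imageD)
  show "finite (dist_rel V E ` {i \<in> I. Poly_Mapping.lookup \<mu> (dist_rel V E i) \<noteq> 0})"
    by (rule finite_subset[OF _ finite_lookup[of \<mu>]]) auto
  show "inj_on (dist_rel V E) {i \<in> I. Poly_Mapping.lookup \<mu> (dist_rel V E i) \<noteq> 0}"
    using inj_dist_rel[OF assms] by (rule inj_on_subset) auto
qed

text \<open>A common index set for several arguments makes bilinearity of the convolution visible.\<close>

lemma graph_conv_eq:
  assumes "finite S" "finite T" "S \<subseteq> I" "T \<subseteq> I"
    and "{i \<in> I. Poly_Mapping.lookup \<mu> (dist_rel V E i) \<noteq> 0} \<subseteq> S"
    and "{i \<in> I. Poly_Mapping.lookup \<nu> (dist_rel V E i) \<noteq> 0} \<subseteq> T"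
  shows "graph_conv V E v\<^sub>0 \<mu> \<nu> = (\<Sum>i\<in>S. \<Sum>j\<in>T.
    free_scale (Poly_Mapping.lookup \<mu> (dist_rel V E i) * Poly_Mapping.lookup \<nu> (dist_rel V E j))
        (conv_basis V E v\<^sub>0 i j))"
proof -
  have "graph_conv V E v\<^sub>0 \<mu> \<nu> = (\<Sum>i | i \<in> I \<and> Poly_Mapping.lookup \<mu> (dist_rel V E i) \<noteq> 0.
      \<Sum>j\<in>T.
      free_scale (Poly_Mapping.lookup \<mu> (dist_rel V E i) * Poly_Mapping.lookup \<nu> (dist_rel V E j))
        (conv_basis V E v\<^sub>0 i j))"
    unfolding graph_conv_def
    by (intro sum.cong refl sum.mono_neutral_left) (use assms in auto)
  also have "\<dots> = (\<Sum>i\<in>S. \<Sum>j\<in>T.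
      free_scale (Poly_Mapping.lookup \<mu> (dist_rel V E i) * Poly_Mapping.lookup \<nu> (dist_rel V E j))
        (conv_basis V E v\<^sub>0 i j))"
    by (intro sum.mono_neutral_left) (use assms in auto)
  finally show ?thesis .
qed

lemma graph_conv_basis_rel:
  assumes "v\<^sub>0 \<in> V" "i \<in> I" "j \<in> I"
  shows "graph_conv V E v\<^sub>0 (R i) (R j) =
    (\<Sum>k | k \<in> I \<and> walk_coeff V E v\<^sub>0 i j k \<noteq> 0.
      free_scale (of_real (walk_coeff V E v\<^sub>0 i j k)) (R k))"
proof -
  \<comment> \<open>Distinct indices give distinct relations, so \<open>R k\<close> is supported at
    \<open>k\<close> alone and the double sum reduces to one term.\<close>
  have supp: "{l \<in> I. Poly_Mapping.lookup (R k) (dist_rel V E l) \<noteq> 0} \<subseteq> {k}" if "k \<in> I" for k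
    using that inj_on_eq_iff[OF inj_dist_rel[OF assms(1)]]
    by (auto simp: basis_rel_def lookup_single when_def)
  have "graph_conv V E v\<^sub>0 (R i) (R j) = conv_basis V E v\<^sub>0 i j"
    using graph_conv_eq[of "{i}" "{j}" "R i" "R j" v\<^sub>0] supp assms
    by (simp add: basis_rel_def)
  then show ?thesis by (simp add: conv_basis_def)
qed

lemma hermitian_basis_R:
  assumes "v\<^sub>0 \<in> V"
  shows "hermitian_basis free_scale I (walk_coeff V E v\<^sub>0) 0 R (graph_conv V E v\<^sub>0)"
proof -
  interpret hermitian_coeffs I "walk_coeff V E v\<^sub>0" 0
    by (rule hermitian_coeffs_walk_coeff[OF assms])
  define f :: "nat \<Rightarrow> 'a rel_space \<Rightarrow> complex" where "f k \<mu> = Poly_Mapping.lookup \<mu> (dist_rel V E k)" for k \<mu>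
  have f: "inj_on R I" "free.independent (R ` I)"
    by (rule free.independent_familyI[of I f];
        simp add: f_def lookup_add basis_rel_def lookup_single when_def
          inj_on_eq_iff[OF inj_dist_rel[OF assms]])+
  define supp where "supp \<mu> = {i \<in> I. Poly_Mapping.lookup \<mu> (dist_rel V E i) \<noteq> 0}" for \<mu> :: "'a rel_space"
  have fin: "finite (supp \<mu>)" for \<mu>
    using finite_rel_support[OF assms] by (simp add: supp_def)
  have sub: "supp \<mu> \<subseteq> I" for \<mu> by (auto simp: supp_def)
  have conv_eq: "graph_conv V E v\<^sub>0 \<mu> \<nu> = (\<Sum>i\<in>S. \<Sum>j\<in>T.
      free_scale (Poly_Mapping.lookup \<mu> (dist_rel V E i) * Poly_Mapping.lookup \<nu> (dist_rel V E j))
        (conv_basis V E v\<^sub>0 i j))"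
    if "finite S" "finite T" "S \<subseteq> I" "T \<subseteq> I" "supp \<mu> \<subseteq> S" "supp \<nu> \<subseteq> T" for \<mu> \<nu> S T
    using graph_conv_eq[OF that[unfolded supp_def]] .
  have supp_add: "supp (\<mu> + \<nu>) \<subseteq> supp \<mu> \<union> supp \<nu>" for \<mu> \<nu>
    by (auto simp: supp_def lookup_add)
  have supp_scale: "supp (free_scale a \<mu>) \<subseteq> supp \<mu>" for a \<mu>
    by (auto simp: supp_def)
  have add_left: "graph_conv V E v\<^sub>0 (x + y) z = graph_conv V E v\<^sub>0 x z + graph_conv V E v\<^sub>0 y z" for x y z
    using supp_add[of x y] fin sub
    by (simp add: conv_eq[of "supp x \<union> supp y" "supp z"] lookup_add distrib_right
        free.scale_left_distrib sum.distrib)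
  have add_right: "graph_conv V E v\<^sub>0 z (x + y) = graph_conv V E v\<^sub>0 z x + graph_conv V E v\<^sub>0 z y" for x y z
    using supp_add[of x y] fin sub
    by (simp add: conv_eq[of "supp z" "supp x \<union> supp y"] lookup_add distrib_left
        free.scale_left_distrib sum.distrib)
  have scale_left: "graph_conv V E v\<^sub>0 (free_scale a x) y = free_scale a (graph_conv V E v\<^sub>0 x y)" for a x y
    using supp_scale[of a x] fin sub
    by (simp add: conv_eq[of "supp x" "supp y"] free.scale_sum_right mult.assoc)
  have scale_right: "graph_conv V E v\<^sub>0 x (free_scale a y) = free_scale a (graph_conv V E v\<^sub>0 x y)" for a x y
    using supp_scale[of a y] fin sub
    by (simp add: conv_eq[of "supp x" "supp y"] free.scale_sum_right mult.left_commute[of _ a])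
  show ?thesis
    by unfold_locales
      (use f graph_conv_basis_rel[OF assms] add_left add_right scale_left scale_right in auto)
qed

end

theorem mainTheorem3:
  fixes V :: "'a set" and E :: "('a \<times> 'a) set" and v\<^sub>0 :: 'a
  assumes "simple_graph V E" and "connected_graph V E" and "finite_degrees V E"
    and "distance_regular V E"
    and "v\<^sub>0 \<in> V"
  defines "I \<equiv> dist_indices V E"
    and "P \<equiv> walk_coeff V E v\<^sub>0"
    and "R \<equiv> basis_rel V E"
    and "C \<equiv> normalized_dist_matrix V E"
  shows "(\<forall>i \<in> I. \<forall>j \<in> I.
            finite {k \<in> I. P i j k \<noteq> 0} \<and>
            mat_prod V (C i) (C j) =
              (\<Sum>k | k \<in> I \<and> P i j k \<noteq> 0. mat_scale (of_real (P i j k)) (C k))) \<and>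
         hermitian_discrete_hypergroup
           mat_scale (C ` I) (mat_prod V) (conj_fixing mat_scale (C ` I)) \<and>
         hermitian_discrete_hypergroup
           free_scale (R ` I) (graph_conv V E v\<^sub>0) (conj_fixing free_scale (R ` I)) \<and>
         (\<exists>\<phi>. hypergroup_iso
                free_scale (R ` I) (graph_conv V E v\<^sub>0) (conj_fixing free_scale (R ` I))
                mat_scale (C ` I) (mat_prod V) (conj_fixing mat_scale (C ` I)) \<phi> \<and>
              (\<forall>i \<in> I. \<phi> (R i) = C i))"
proof -
  interpret distance_regular_graph V E by unfold_locales fact+
  \<comment> \<open>Relations and matrices have the same structure constants, so the hypergroup
    property and the isomorphism both follow from the general results on
    \<open>hermitian_basis\<close>.\<close>
  note bases = hermitian_basis_R[OF assms(5)] hermitian_basis_C[OF assms(5)]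
  show ?thesis
    unfolding I_def P_def R_def C_def
    using finite_walk_coeff[OF assms(5)] mat_prod_C[OF assms(5)]
      hypergroup_iso_of_same_coeffs[OF bases]
      bases[THEN hermitian_basis.hermitian_discrete_hypergroup]
    by blast
qed

end
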